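(* Let $L$ be a partial lattice on $n$ elements having a top element, and let $d$ be the maximum degree of any element of $L$. There is a data structure for $L$ that requires $O(n^{3/2})$ words of space and computes the join of two elements in $O(\sqrt n + d)$ time.
   Context: Model: word RAM with $\Theta(\log n)$-bit words; space measured in words. A partial lattice is a finite partially ordered set in which, whenever $x_1,x_2<y_1,y_2$, there exists $z$ with $x_1,x_2\le z\le y_1,y_2$; the join of $x,y$ is the unique least element of $\{z : z\ge x, z \ge y\}$. The transitive reduction graph of $L$ has an edge $(u,v)$ whenever $u<v$ and no $w$ satisfies $u<w<v$ (then $v$ covers $u$). The degree of an element is its number of in-neighbours in the transitive reduction graph, i.e. the number of elements it covers. The assumption that $L$ has a top element is a standing assumption of the section containing this result. *)

theory Defs
  imports Complex_Main "HOL-Algebra.Lattice"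
begin

section \<open>Partial lattices\<close>

locale partial_lattice = partial_order L for L (structure) +
  assumes finite_carrier: "finite (carrier L)"
    and interpolation:
      "\<lbrakk>x1 \<in> carrier L; x2 \<in> carrier L; y1 \<in> carrier L; y2 \<in> carrier L;
        x1 \<sqsubset> y1; x1 \<sqsubset> y2; x2 \<sqsubset> y1; x2 \<sqsubset> y2\<rbrakk>
       \<Longrightarrow> \<exists>z \<in> carrier L. x1 \<sqsubseteq> z \<and> x2 \<sqsubseteq> z \<and> z \<sqsubseteq> y1 \<and> z \<sqsubseteq> y2"

definition transitive_reduction :: "('a, 'b) gorder_scheme \<Rightarrow> ('a \<times> 'a) set" where
  "transitive_reduction L =
     {(u, v). u \<in> carrier L \<and> v \<in> carrier L \<and> u \<sqsubset>\<^bsub>L\<^esub> v \<and>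
        \<not> (\<exists>w \<in> carrier L. u \<sqsubset>\<^bsub>L\<^esub> w \<and> w \<sqsubset>\<^bsub>L\<^esub> v)}"

definition degree :: "('a, 'b) gorder_scheme \<Rightarrow> 'a \<Rightarrow> nat" where
  "degree L v = card {u. (u, v) \<in> transitive_reduction L}"

definition max_degree :: "('a, 'b) gorder_scheme \<Rightarrow> nat" where
  "max_degree L = Max (degree L ` carrier L)"

text \<open>
  The library's join is a Hilbert choice among the least upper bounds. In a partial lattice with
  a top element it always denotes the unique least upper bound:
\<close>

lemma (in partial_lattice) join_least:
  assumes "greatest L t (carrier L)" and x: "x \<in> carrier L" and y: "y \<in> carrier L"
  shows "least L (x \<squnion> y) (Upper L {x, y})"
proof -
  let ?U = "Upper L {x, y}"
  have U: "u \<in> ?U \<longleftrightarrow> u \<in> carrier L \<and> x \<sqsubseteq> u \<and> y \<sqsubseteq> u" for u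
    using x y by (auto simp: Upper_def)
  have less: "a \<sqsubset> b" if "a \<sqsubseteq> b" "a \<noteq> b" for a b
    using that by (simp add: lless_def eq_is_equal)
  have lower: "\<exists>z \<in> ?U. z \<sqsubseteq> a \<and> z \<sqsubseteq> b" if a: "a \<in> ?U" and b: "b \<in> ?U" for a b
  proof (cases "a \<in> {x, y} \<or> b \<in> {x, y}")
    case True
    then have "a \<sqsubseteq> b \<or> b \<sqsubseteq> a" using a b unfolding U by auto
    moreover have "a \<sqsubseteq> a" "b \<sqsubseteq> b" using a b unfolding U by auto
    ultimately show ?thesis using a b by blast
  next
    case False
    then show ?thesis
      using interpolation[OF x y, of a b] a b less[of x] less[of y] unfolding U Bex_def
      by (metis insertCI)
  qed
  have bound: "\<exists>z \<in> ?U. \<forall>v \<in> V. z \<sqsubseteq> v" if "finite V" "V \<subseteq> ?U" for V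
    using that
  proof (induction V)
    case empty
    have "t \<in> ?U" using assms unfolding U greatest_def by auto
    then show ?case by auto
  next
    case (insert v V)
    then obtain z where z: "z \<in> ?U" "\<forall>v \<in> V. z \<sqsubseteq> v" by auto
    obtain z' where z': "z' \<in> ?U" "z' \<sqsubseteq> z" "z' \<sqsubseteq> v"
      using lower[of z v] z(1) insert.prems by auto
    have "z' \<sqsubseteq> v'" if "v' \<in> V" for v'
    proof (rule le_trans)
      show "z' \<sqsubseteq> z" by (fact z'(2))
      show "z \<sqsubseteq> v'" using z(2) that by simp
      show "z' \<in> carrier L" "z \<in> carrier L" using z'(1) z(1) by (simp_all add: U)
      show "v' \<in> carrier L" using insert.prems that U by auto
    qed
    then show ?case using z' by auto
  qed
  have "finite ?U"
    by (rule finite_subset[OF _ finite_carrier]) (simp add: U subset_iff)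
  then obtain z where "z \<in> ?U" "\<forall>v \<in> ?U. z \<sqsubseteq> v" using bound[of ?U] by auto
  then have "least L z ?U" by (simp add: least_def Upper_closed)
  then show ?thesis unfolding join_def sup_def by (rule someI)
qed

section \<open>The word RAM\<close>

text \<open>
  A machine with word length \<open>w\<close> has words \<open>0, \<dots>, 2 ^ w - 1\<close>, a memory that is an array of words,
  and registers named by the numbers occurring in its program. A program is a fixed finite
  list, so it uses a constant number of registers. Every instruction costs one time unit.
\<close>

datatype word_op = WAdd | WSub | WMul | WDiv | WMod | WAnd | WOr | WXor | WShl | WShr

text \<open>Arithmetic is modulo \<open>2 ^ w\<close>; division by zero yields zero.\<close>

fun eval_op :: "nat \<Rightarrow> word_op \<Rightarrow> nat \<Rightarrow> nat \<Rightarrow> nat" where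
  "eval_op w WAdd a b = take_bit w (a + b)"
| "eval_op w WSub a b = take_bit w (a + 2 ^ w - b)"
| "eval_op w WMul a b = take_bit w (a * b)"
| "eval_op w WDiv a b = take_bit w (a div b)"
| "eval_op w WMod a b = take_bit w (a mod b)"
| "eval_op w WAnd a b = take_bit w (Bit_Operations.and a b)"
| "eval_op w WOr a b = take_bit w (Bit_Operations.or a b)"
| "eval_op w WXor a b = take_bit w (Bit_Operations.xor a b)"
| "eval_op w WShl a b = take_bit w (push_bit b a)"
| "eval_op w WShr a b = take_bit w (drop_bit b a)"

datatype instr =
    Const nat nat               \<comment> \<open>\<open>Const r k\<close>: \<open>r := k\<close>\<close>
  | Move nat nat                \<comment> \<open>\<open>Move r a\<close>: \<open>r := a\<close>\<close>
  | Op word_op nat nat nat      \<comment> \<open>\<open>Op f r a b\<close>: \<open>r := f a b\<close>\<close>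
  | Load nat nat                \<comment> \<open>\<open>Load r a\<close>: \<open>r := memory[a]\<close>\<close>
  | Store nat nat               \<comment> \<open>\<open>Store a b\<close>: \<open>memory[a] := b\<close>\<close>
  | Jump nat
  | JumpEq nat nat nat          \<comment> \<open>\<open>JumpEq a b l\<close>: if \<open>a = b\<close> go to \<open>l\<close>\<close>
  | JumpLess nat nat nat        \<comment> \<open>\<open>JumpLess a b l\<close>: if \<open>a < b\<close> go to \<open>l\<close>\<close>
  | Halt

type_synonym program = "instr list"

record ram_state =
  pc :: nat
  regs :: "nat \<Rightarrow> nat"
  mem :: "nat list"

fun exec_instr :: "nat \<Rightarrow> instr \<Rightarrow> ram_state \<Rightarrow> ram_state option" where
  "exec_instr w (Const r k) s =
     Some (s\<lparr>pc := pc s + 1, regs := (regs s)(r := take_bit w k)\<rparr>)"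
| "exec_instr w (Move r a) s =
     Some (s\<lparr>pc := pc s + 1, regs := (regs s)(r := regs s a)\<rparr>)"
| "exec_instr w (Op f r a b) s =
     Some (s\<lparr>pc := pc s + 1, regs := (regs s)(r := eval_op w f (regs s a) (regs s b))\<rparr>)"
| "exec_instr w (Load r a) s =
     (if regs s a < length (mem s)
      then Some (s\<lparr>pc := pc s + 1, regs := (regs s)(r := mem s ! regs s a)\<rparr>) else None)"
| "exec_instr w (Store a b) s =
     (if regs s a < length (mem s)
      then Some (s\<lparr>pc := pc s + 1, mem := (mem s)[regs s a := regs s b]\<rparr>) else None)"
| "exec_instr w (Jump l) s = Some (s\<lparr>pc := l\<rparr>)"
| "exec_instr w (JumpEq a b l) s =
     Some (s\<lparr>pc := (if regs s a = regs s b then l else pc s + 1)\<rparr>)"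
| "exec_instr w (JumpLess a b l) s =
     Some (s\<lparr>pc := (if regs s a < regs s b then l else pc s + 1)\<rparr>)"
| "exec_instr w Halt s = None"

text \<open>
  \<open>None\<close> means that no step is possible: the machine has halted, or it has faulted by leaving the
  program or by addressing a cell outside the memory.
\<close>

definition step :: "nat \<Rightarrow> program \<Rightarrow> ram_state \<Rightarrow> ram_state option" where
  "step w P s = (if pc s < length P then exec_instr w (P ! pc s) s else None)"

fun steps :: "nat \<Rightarrow> program \<Rightarrow> nat \<Rightarrow> ram_state \<Rightarrow> ram_state option" where
  "steps w P 0 s = Some s"
| "steps w P (Suc t) s = Option.bind (step w P s) (steps w P t)"

definition halted :: "program \<Rightarrow> ram_state \<Rightarrow> bool" where
  "halted P s \<longleftrightarrow> pc s < length P \<and> P ! pc s = Halt"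

definition query_state :: "nat list \<Rightarrow> nat \<Rightarrow> nat \<Rightarrow> ram_state" where
  "query_state M x y = \<lparr>pc = 0, regs = (\<lambda>_. 0)(0 := x, 1 := y), mem = M\<rparr>"

text \<open>
  The query \<open>(x, y)\<close> on the stored data \<open>M\<close> returns \<open>z\<close> (in register 0) after \<open>t\<close> steps. Stores are
  permitted, but any scratch space has to be part of \<open>M\<close>, and \<open>M\<close> has to be restored, so that any
  sequence of queries can be answered.
\<close>

definition answers_in ::
  "nat \<Rightarrow> program \<Rightarrow> nat list \<Rightarrow> nat \<Rightarrow> nat \<Rightarrow> nat \<Rightarrow> nat \<Rightarrow> bool" where
  "answers_in w P M x y z t \<longleftrightarrow>
     (\<exists>s. steps w P t (query_state M x y) = Some s \<and> halted P s \<and> regs s 0 = z \<and> mem s = M)"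

text \<open>
  \<open>M\<close> is a static data structure for the joins of \<open>L\<close>, whose elements are numbers and serve as
  their own identifiers in queries and answers. It occupies at most \<open>S\<close> words of length \<open>w\<close>, and
  the query program \<open>P\<close> answers every query in time at most \<open>T\<close>.
\<close>

definition join_structure ::
  "nat \<Rightarrow> program \<Rightarrow> nat gorder \<Rightarrow> nat list \<Rightarrow> real \<Rightarrow> real \<Rightarrow> bool" where
  "join_structure w P L M S T \<longleftrightarrow>
     (\<forall>m \<in> set M. m < 2 ^ w) \<and> real (length M) \<le> S \<and>
     (\<forall>x \<in> carrier L. \<forall>y \<in> carrier L.
        \<exists>t. real t \<le> T \<and> answers_in w P M x y (x \<squnion>\<^bsub>L\<^esub> y) t)"

end

theory Submission
  imports Defs "HOL-Library.Tree"
begin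

text \<open>
  Let \<open>k = \<lceil>sqrt n\<rceil>\<close>. Repeatedly choose a minimal element \<open>h\<close> with at least \<open>k\<close> remaining elements
  below it (or the top, if there is none) and remove the elements below \<open>h\<close> as a block with header \<open>h\<close>.
  There are at most \<open>k + 1\<close> blocks, and below an element other than the header a block
  has fewer than \<open>k\<close> elements.

  Order test. The elements of a block that are below a given \<open>z\<close> are directed by interpolation, so if
  there are any, they are the elements of the block below one of its members \<open>p\<close>. Storing \<open>p\<close> for each \<open>z\<close> and
  each block, and a perfect hash table of \<open>O(k)\<close> words for the part of its block below each
  non-header \<open>p\<close>, decides \<open>x \<sqsubseteq> z\<close> in constant time.

  Query. The join of \<open>x\<close> and \<open>y\<close> lies in the block of the first header above both. If it is not the
  header itself, it is below a child of the header in the same block, and below the first such child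
  that bounds \<open>x\<close> and \<open>y\<close> there are fewer than \<open>k\<close> candidates. The join is the first upper bound in a
  linear extension of these. The three scans of at most \<open>k + 1\<close>, \<open>d\<close> and \<open>k\<close> elements form a single
  decision tree with \<open>O(n k)\<close> nodes, as every element is a child in at most one block.
\<close>

section \<open>Membership tables by double displacement\<close>

text \<open>Averaging: the collision sets of distinct shifts are pairwise disjoint subsets of
  \<open>A \<times> B\<close>, so one of the \<open>N\<close> shifts gets at most an average
  share.\<close>

lemma exists_shift_few_collisions:
  fixes \<alpha> :: "'a \<Rightarrow> nat" and \<beta> :: "'b \<Rightarrow> nat"
  assumes "finite A" "finite B" "0 < N"
  shows "\<exists>a<N. N * card {(p, q) \<in> A \<times> B. \<alpha> p = \<beta> q + a} \<le> card A * card B"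
proof (rule ccontr)
  let ?C = "\<lambda>a. {(p, q) \<in> A \<times> B. \<alpha> p = \<beta> q + a}"
  assume "\<not> ?thesis"
  then have less: "card A * card B < N * card (?C a)" if "a < N" for a
    using that by (meson not_le)
  have fin: "finite (?C a)" for a
    by (rule finite_subset[of _ "A \<times> B"]) (use assms in auto)
  have "N * (card A * card B) = (\<Sum>a<N. card A * card B)" by simp
  also have "\<dots> < (\<Sum>a<N. N * card (?C a))"
    using less \<open>0 < N\<close> by (intro sum_strict_mono) auto
  also have "\<dots> = N * card (\<Union>a<N. ?C a)"
    using fin by (subst card_UN_disjoint) (auto simp: sum_distrib_left)
  also have "\<dots> \<le> N * card (A \<times> B)"
    by (intro mult_le_mono2 card_mono) (use assms in auto)
  finally show False by (simp add: card_cartesian_product)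
qed

text \<open>
  Static membership tables in the manner of Tarjan and Yao's double displacement: a sparse set of
  pairs is made injective modulo a shift of the columns with few collisions, and the rows thus
  obtained, inserted by decreasing size, can then be shifted apart, because
  large rows account for many of the collisions.
\<close>

lemma exists_column_shifts:
  fixes S :: "(nat \<times> nat) set"
  assumes "finite S" "card S \<le> k"
  shows "\<exists>g. (\<forall>v. g v < k + 1) \<and>
    card {(p, q) \<in> S \<times> S. fst p + g (snd p) = fst q + g (snd q)} \<le> 3 * card S"
proof -
  define cols where "cols V = {p \<in> S. snd p < V}" for V
  define coll where "coll g X Y = {(p, q) \<in> X \<times> Y. fst p + g (snd p) = fst q + g (snd q)}"
    for g :: "nat \<Rightarrow> nat" and X Y :: "(nat \<times> nat) set"
  have *: "\<exists>g. (\<forall>v. g v < k + 1) \<and> card (coll g (cols V) (cols V)) \<le> 3 * card (cols V)" for V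
  proof (induction V)
    case 0
    show ?case by (rule exI[of _ "\<lambda>_. 0"]) (simp add: cols_def coll_def)
  next
    case (Suc V)
    then obtain g where g: "\<forall>v. g v < k + 1"
      and IH: "card (coll g (cols V) (cols V)) \<le> 3 * card (cols V)" by blast
    define B where "B = {p \<in> S. snd p = V}"
    let ?A = "cols V"
    have fin: "finite ?A" "finite B" using assms by (auto simp: cols_def B_def)
    obtain a where a: "a < k + 1"
      and few: "(k + 1) * card {(p, q) \<in> ?A \<times> B. fst p + g (snd p) = fst q + a} \<le> card ?A * card B"
      using exists_shift_few_collisions[OF fin, of "k + 1" "\<lambda>p. fst p + g (snd p)" fst] by auto
    note few
    \<comment> \<open>Since \<open>card ?A \<le> k\<close>, the average over \<open>k + 1\<close>
      shifts is at most \<open>card B\<close>.\<close>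
    also have "card ?A * card B \<le> (k + 1) * card B"
      using card_mono[of S ?A] assms by (intro mult_le_mono1) (auto simp: cols_def)
    finally have cross: "card {(p, q) \<in> ?A \<times> B. fst p + g (snd p) = fst q + a} \<le> card B"
      by (simp only: nat_mult_le_cancel1)
    \<comment> \<open>The new column adds at most \<open>3 * card B\<close> ordered pairs:
      \<open>card B\<close> for each of the two mirrored mixed parts, and the diagonal of
      \<open>B\<close>, as pairs colliding within one column are equal.\<close>
    define g' where "g' = g(V := a)"
    have AA: "coll g' ?A ?A = coll g ?A ?A"
      by (auto simp: coll_def g'_def cols_def)
    have AB: "coll g' ?A B = {(p, q) \<in> ?A \<times> B. fst p + g (snd p) = fst q + a}"
      by (auto simp: coll_def g'_def cols_def B_def)
    have BA: "coll g' B ?A = prod.swap ` coll g' ?A B"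
      by (auto simp: coll_def image_iff)
    have BB: "coll g' B B = (\<lambda>p. (p, p)) ` B"
      by (auto simp: coll_def B_def)
    have SV: "cols (Suc V) = ?A \<union> B" and disj: "?A \<inter> B = {}"
      by (auto simp: cols_def B_def)
    have "coll g' (cols (Suc V)) (cols (Suc V)) =
        (coll g' ?A ?A \<union> coll g' ?A B) \<union> (coll g' B ?A \<union> coll g' B B)"
      unfolding SV by (auto simp: coll_def)
    then have "card (coll g' (cols (Suc V)) (cols (Suc V))) \<le>
        (card (coll g' ?A ?A) + card (coll g' ?A B)) + (card (coll g' B ?A) + card (coll g' B B))"
      by (auto intro!: order_trans[OF card_Un_le] add_mono card_Un_le)
    moreover have "card (coll g' B ?A) \<le> card B"
      unfolding BA using cross AB by (simp add: card_image)
    moreover have "card (coll g' B B) \<le> card B"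
      unfolding BB using fin by (simp add: card_image_le)
    moreover have "card (coll g' ?A B) \<le> card B" using cross AB by simp
    moreover have "card (coll g' ?A ?A) \<le> 3 * card ?A" using IH AA by simp
    moreover have "card (cols (Suc V)) = card ?A + card B"
      unfolding SV using fin disj by (simp add: card_Un_disjoint)
    ultimately have "card (coll g' (cols (Suc V)) (cols (Suc V))) \<le> 3 * card (cols (Suc V))"
      by linarith
    moreover have "\<forall>v. g' v < k + 1" using g a by (simp add: g'_def)
    ultimately show ?case by blast
  qed
  have "snd p \<le> Max (snd ` S)" if "p \<in> S" for p using that assms by simp
  then have "cols (Suc (Max (snd ` S))) = S"
    by (auto simp: cols_def less_Suc_eq_le)
  then show ?thesis using *[of "Suc (Max (snd ` S))"] by (simp only: coll_def)
qed

text \<open>The hypothesis bounds the sum of the squared row sizes. A row inserted after rows at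
  least as large has a product with their total size that is at most this sum, so one of
  \<open>N + 1\<close> shifts avoids every collision.\<close>

lemma exists_row_shifts:
  fixes S :: "(nat \<times> nat) set" and \<rho> :: "nat \<times> nat \<Rightarrow> nat"
  assumes "finite S" and "card {(p, q) \<in> S \<times> S. \<rho> p = \<rho> q} \<le> N"
    and row: "\<And>p q. \<lbrakk>p \<in> S; q \<in> S; \<rho> p = \<rho> q; snd p = snd q\<rbrakk> \<Longrightarrow> p = q"
  shows "\<exists>f. (\<forall>r. f r \<le> N) \<and> inj_on (\<lambda>p. f (\<rho> p) + snd p) S"
proof -
  define R where "R r = {p \<in> S. \<rho> p = r}" for r
  have finR: "finite (R r)" for r using assms by (simp add: R_def)
  have *: "\<exists>f. (\<forall>r. f r \<le> N) \<and> inj_on (\<lambda>p. f (\<rho> p) + snd p) {p \<in> S. \<rho> p \<in> W}"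
    if "finite W" for W
    using that
  \<comment> \<open>Negating the sizes makes the induction insert rows by decreasing size.\<close>
  proof (induction W rule: finite_ranking_induct[where f = "\<lambda>r. - int (card (R r))"])
    case empty
    show ?case by (rule exI[of _ "\<lambda>_. 0"]) simp
  next
    case (insert r W)
    then obtain f where f: "\<forall>r. f r \<le> N" and inj: "inj_on (\<lambda>p. f (\<rho> p) + snd p) {p \<in> S. \<rho> p \<in> W}"
      by blast
    have larger: "card (R r) \<le> card (R r')" if "r' \<in> W" for r' using insert that by auto
    let ?A = "{p \<in> S. \<rho> p \<in> W}"
    show ?case
    proof (cases "r \<in> W")
      case True
      then show ?thesis using f inj by (auto simp: insert_absorb)
    next
      case False
      have "?A = (\<Union>r'\<in>W. R r')" by (auto simp: R_def)
      then have "card ?A = (\<Sum>r'\<in>W. card (R r'))"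
        using insert finR by (simp add: card_UN_disjoint R_def Int_def disjoint_iff)
      then have "card ?A * card (R r) = (\<Sum>r'\<in>W. card (R r') * card (R r))"
        by (simp add: sum_distrib_right)
      also have "\<dots> \<le> (\<Sum>r'\<in>W. card (R r' \<times> R r'))"
        by (intro sum_mono) (simp add: card_cartesian_product larger)
      also have "\<dots> = card (\<Union>r'\<in>W. R r' \<times> R r')"
        using insert finR by (subst card_UN_disjoint) (auto simp: R_def)
      also have "\<dots> \<le> card {(p, q) \<in> S \<times> S. \<rho> p = \<rho> q}"
        by (rule card_mono, rule finite_subset[of _ "S \<times> S"])
           (use assms in \<open>auto simp: R_def\<close>)
      finally have few: "card ?A * card (R r) < N + 1" using assms by simp
      have finA: "finite ?A" using assms by simp
      obtain a where a: "a < N + 1"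
        and col: "(N + 1) * card {(p, q) \<in> ?A \<times> R r. f (\<rho> p) + snd p = snd q + a} \<le> card ?A * card (R r)"
        using exists_shift_few_collisions[OF finA finR[of r], of "N + 1" "\<lambda>p. f (\<rho> p) + snd p" snd]
        by auto
      have "finite {(p, q) \<in> ?A \<times> R r. f (\<rho> p) + snd p = snd q + a}"
        by (rule finite_subset[of _ "?A \<times> R r"]) (use finA finR in auto)
      moreover have "card {(p, q) \<in> ?A \<times> R r. f (\<rho> p) + snd p = snd q + a} = 0"
      proof (rule ccontr)
        assume "card {(p, q) \<in> ?A \<times> R r. f (\<rho> p) + snd p = snd q + a} \<noteq> 0"
        then have "N + 1 \<le> (N + 1) * card {(p, q) \<in> ?A \<times> R r. f (\<rho> p) + snd p = snd q + a}"
          by (cases "card {(p, q) \<in> ?A \<times> R r. f (\<rho> p) + snd p = snd q + a}") auto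
        then show False using col few by linarith
      qed
      ultimately have none: "{(p, q) \<in> ?A \<times> R r. f (\<rho> p) + snd p = snd q + a} = {}" by simp
      let ?f = "f(r := a)"
      have eq: "p = q" if pq: "p \<in> S" "q \<in> S" "\<rho> p \<in> insert r W" "\<rho> q \<in> insert r W"
        "?f (\<rho> p) + snd p = ?f (\<rho> q) + snd q" for p q
      proof -
        consider "\<rho> p \<in> W" "\<rho> q \<in> W" | "\<rho> p = r" "\<rho> q = r"
          | "\<rho> p \<in> W" "\<rho> q = r" | "\<rho> p = r" "\<rho> q \<in> W"
          using pq(3,4) by blast
        then show ?thesis
        proof cases
          case 1
          then have "f (\<rho> p) + snd p = f (\<rho> q) + snd q" using pq False by (auto split: if_splits)
          then show ?thesis using inj 1 pq by (auto dest: inj_onD)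
        next
          case 2
          then show ?thesis using pq row by simp
        next
          case 3
          then have "(p, q) \<in> {(p, q) \<in> ?A \<times> R r. f (\<rho> p) + snd p = snd q + a}"
            using pq False by (auto simp: R_def split: if_splits)
          then show ?thesis unfolding none by simp
        next
          case 4
          then have "(q, p) \<in> {(p, q) \<in> ?A \<times> R r. f (\<rho> p) + snd p = snd q + a}"
            using pq False by (auto simp: R_def split: if_splits)
          then show ?thesis unfolding none by simp
        qed
      qed
      show ?thesis
        by (rule exI[of _ ?f]) (use f a eq in \<open>auto simp: inj_on_def less_Suc_eq_le\<close>)
    qed
  qed
  have "{p \<in> S. \<rho> p \<in> \<rho> ` S} = S" by blast
  then show ?thesis using *[OF finite_imageI[OF assms(1)], of \<rho>] by simp
qed

text \<open>The number \<open>x\<close> is the cell \<open>(x div k, x mod k)\<close> of a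
  \<open>k\<close> by \<open>k\<close> grid. The first \<open>7 * k\<close> entries of
  \<open>E\<close> hold \<open>k\<close> column shifts, \<open>2 * k\<close> row shifts and
  \<open>4 * k\<close> positions for elements, one segment for each of the three nested
  accesses.\<close>

lemma exists_membership_table:
  fixes D :: "nat set"
  assumes "D \<subseteq> {..<n}" "card D \<le> k" "n \<le> k * k"
  shows "\<exists>E. (\<forall>i. E i \<le> 6 * k + n) \<and> (\<forall>x<n.
     E (x mod k) + x div k < 3 * k \<and>
     E (E (x mod k) + x div k) + x mod k < 7 * k \<and>
     (E (E (E (x mod k) + x div k) + x mod k) = x \<longleftrightarrow> x \<in> D))"
proof (cases "k = 0")
  case False
  define \<phi> where "\<phi> x = (x div k, x mod k)" for x
  have inj\<phi>: "inj \<phi>"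
    unfolding \<phi>_def inj_def by (metis div_mult_mod_eq prod.inject)
  have fin: "finite (\<phi> ` D)" and card: "card (\<phi> ` D) \<le> k"
    using assms finite_subset[of D] inj\<phi> by (auto simp: card_image inj_on_subset)
  obtain g where g: "\<forall>v. g v < k + 1" and few:
    "card {(p, q) \<in> \<phi> ` D \<times> \<phi> ` D. fst p + g (snd p) = fst q + g (snd q)} \<le> 3 * card (\<phi> ` D)"
    using exists_column_shifts[OF fin card] by blast
  let ?\<rho> = "\<lambda>p. fst p + g (snd p)"
  obtain f where f: "\<forall>r. f r \<le> 3 * k" and inj: "inj_on (\<lambda>p. f (?\<rho> p) + snd p) (\<phi> ` D)"
    using exists_row_shifts[OF fin, of ?\<rho> "3 * k"] few card by (auto simp: prod_eq_iff)
  define pos where "pos x = f (?\<rho> (\<phi> x)) + snd (\<phi> x)" for x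
  have inj_pos: "inj_on pos D"
    using comp_inj_on[OF inj_on_subset[OF inj\<phi>] inj] by (simp add: pos_def[abs_def] comp_def)
  \<comment> \<open>The filler \<open>n\<close> differs from every queried
    \<open>x < n\<close>.\<close>
  define T where "T c = (if c \<in> pos ` D then inv_into D pos c else n)" for c
  have T: "T (pos x) = x \<longleftrightarrow> x \<in> D" if "x < n" for x
  proof
    assume "T (pos x) = x"
    then show "x \<in> D" using that inv_into_into[of "pos x" pos D] by (simp add: T_def split: if_splits)
  next
    assume "x \<in> D"
    then show "T (pos x) = x" by (simp add: T_def inv_into_f_f[OF inj_pos])
  qed
  have T_le: "T c \<le> n" for c
    using assms inv_into_into[of c pos D] by (force simp: T_def)
  \<comment> \<open>Stored shifts already include the base \<open>k\<close> or \<open>3 * k\<close>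
    of the next segment, so a query adds only the quotient or the remainder.\<close>
  define E where
    "E i = (if i < k then k + g i else if i < 3 * k then 3 * k + f (i - k) else T (i - 3 * k))" for i
  have "E i \<le> 6 * k + n" for i
    using g[rule_format, of i] f[rule_format, of "i - k"] T_le[of "i - 3 * k"] by (auto simp: E_def)
  moreover have "E (x mod k) + x div k < 3 * k \<and>
     E (E (x mod k) + x div k) + x mod k < 7 * k \<and>
     (E (E (E (x mod k) + x div k) + x mod k) = x \<longleftrightarrow> x \<in> D)" if "x < n" for x
  proof -
    have v: "x mod k < k" and u: "x div k < k"
      using False that assms by (auto simp: less_mult_imp_div_less)
    let ?r = "x div k + g (x mod k)"
    have 1: "E (x mod k) = k + g (x mod k)" using v by (simp add: E_def)
    have r: "k + ?r < 3 * k" using u g[rule_format, of "x mod k"] by simp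
    have 2: "E (k + ?r) = 3 * k + f ?r" using r by (simp add: E_def)
    have 3: "E (3 * k + f ?r + x mod k) = T (pos x)"
      by (simp add: E_def pos_def \<phi>_def)
    have 4: "E (x mod k) + x div k = k + ?r" using 1 by simp
    have "3 * k + f ?r + x mod k < 7 * k" using v f[rule_format, of ?r] by linarith
    then show ?thesis unfolding 4 2 3 using r T[OF that] by simp
  qed
  ultimately show ?thesis by blast
qed (use assms in \<open>auto intro!: exI[of _ "\<lambda>_. 0"]\<close>)

section \<open>Block decomposition of a partial lattice\<close>

context partial_lattice
begin

section \<open>Interpolation, ranks and linear extensions\<close>

lemma lless_iff: "x \<sqsubset> y \<longleftrightarrow> x \<sqsubseteq> y \<and> x \<noteq> y"
  by (simp add: lless_def eq_is_equal)

lemma weak_interpolation: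
  assumes "x1 \<in> carrier L" "x2 \<in> carrier L" "y1 \<in> carrier L" "y2 \<in> carrier L"
    "x1 \<sqsubseteq> y1" "x1 \<sqsubseteq> y2" "x2 \<sqsubseteq> y1" "x2 \<sqsubseteq> y2"
  shows "\<exists>z \<in> carrier L. x1 \<sqsubseteq> z \<and> x2 \<sqsubseteq> z \<and> z \<sqsubseteq> y1 \<and> z \<sqsubseteq> y2"
proof (cases "x1 = y1 \<or> x1 = y2 \<or> x2 = y1 \<or> x2 = y2")
  case True
  then show ?thesis using assms le_refl by blast
next
  case False
  then show ?thesis using interpolation[OF assms(1-4)] assms by (simp add: lless_iff)
qed

text \<open>The size of the down-set serves as a rank, from which minimal elements, covers and
  linear extensions are obtained.\<close>

lemma card_down_less:
  assumes "u \<in> carrier L" "v \<in> carrier L" "u \<sqsubseteq> v" "u \<noteq> v"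
  shows "card {x \<in> carrier L. x \<sqsubseteq> u} < card {x \<in> carrier L. x \<sqsubseteq> v}"
proof (rule psubset_card_mono)
  show "finite {x \<in> carrier L. x \<sqsubseteq> v}" using finite_carrier by simp
  have "{x \<in> carrier L. x \<sqsubseteq> u} \<subseteq> {x \<in> carrier L. x \<sqsubseteq> v}"
    using assms le_trans[of _ u v] by blast
  moreover have "v \<in> {x \<in> carrier L. x \<sqsubseteq> v}" "v \<notin> {x \<in> carrier L. x \<sqsubseteq> u}"
    using assms le_antisym[of u v] by auto
  ultimately show "{x \<in> carrier L. x \<sqsubseteq> u} \<subset> {x \<in> carrier L. x \<sqsubseteq> v}" by blast
qed

lemma exists_minimal:
  assumes "X \<subseteq> carrier L" "X \<noteq> {}"
  shows "\<exists>m\<in>X. \<forall>u\<in>X. u \<sqsubseteq> m \<longrightarrow> u = m"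
proof -
  let ?f = "\<lambda>m. card {u \<in> carrier L. u \<sqsubseteq> m}"
  obtain m where m: "m \<in> X" and min: "\<And>u. u \<in> X \<Longrightarrow> ?f m \<le> ?f u"
    using ex_has_least_nat[of "\<lambda>m. m \<in> X" _ ?f] assms by blast
  have "u = m" if u: "u \<in> X" "u \<sqsubseteq> m" for u
  proof (rule ccontr)
    assume "u \<noteq> m"
    then have "?f u < ?f m" using card_down_less[of u m] u m assms by blast
    then show False using min[OF u(1)] by simp
  qed
  then show ?thesis using m by blast
qed

lemma exists_greatest_if_directed:
  assumes "X \<subseteq> carrier L" "X \<noteq> {}"
    and dir: "\<And>a b. \<lbrakk>a \<in> X; b \<in> X\<rbrakk> \<Longrightarrow> \<exists>c\<in>X. a \<sqsubseteq> c \<and> b \<sqsubseteq> c"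
  shows "\<exists>m\<in>X. \<forall>u\<in>X. u \<sqsubseteq> m"
proof -
  have bound: "\<exists>m\<in>X. \<forall>u\<in>V. u \<sqsubseteq> m" if "finite V" "V \<subseteq> X" for V
    using that
  proof (induction V)
    case empty
    then show ?case using assms by auto
  next
    case (insert v V)
    then obtain m where m: "m \<in> X" "\<forall>u\<in>V. u \<sqsubseteq> m" by auto
    obtain c where "c \<in> X" "m \<sqsubseteq> c" "v \<sqsubseteq> c" using dir[of m v] m insert by auto
    moreover have "u \<sqsubseteq> c" if "u \<in> V" for u
      by (rule le_trans[of u m c]) (use that m calculation assms insert.prems in auto)
    ultimately show ?case by auto
  qed
  show ?thesis
    by (rule bound) (simp_all add: finite_subset[OF assms(1) finite_carrier])
qed

text \<open>An element of largest rank in the half-open interval from \<open>z\<close> to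
  \<open>h\<close> leaves no room below \<open>h\<close>.\<close>

lemma exists_cover_above:
  assumes "z \<in> carrier L" "h \<in> carrier L" "z \<sqsubset> h"
  shows "\<exists>e\<in>carrier L. z \<sqsubseteq> e \<and> (e, h) \<in> transitive_reduction L"
proof -
  let ?X = "{e \<in> carrier L. z \<sqsubseteq> e \<and> e \<sqsubset> h}"
  let ?f = "\<lambda>e. card {u \<in> carrier L. u \<sqsubseteq> e}"
  have "z \<in> ?X" using assms by simp
  moreover have "\<forall>e. e \<in> ?X \<longrightarrow> ?f e < Suc (card (carrier L))"
    using finite_carrier by (auto intro!: card_mono simp: less_Suc_eq_le)
  ultimately obtain e where e: "e \<in> ?X" and max: "\<And>u. u \<in> ?X \<Longrightarrow> ?f u \<le> ?f e"
    using ex_has_greatest_nat[of "\<lambda>e. e \<in> ?X" z ?f] by blast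
  have "\<not> (\<exists>w\<in>carrier L. e \<sqsubset> w \<and> w \<sqsubset> h)"
  proof
    assume "\<exists>w\<in>carrier L. e \<sqsubset> w \<and> w \<sqsubset> h"
    then obtain w where w: "w \<in> carrier L" "e \<sqsubset> w" "w \<sqsubset> h" by blast
    then have "w \<in> ?X" using e assms le_trans[of z e w] by (auto simp: lless_iff)
    moreover have "?f e < ?f w" using card_down_less[of e w] w e by (simp add: lless_iff)
    ultimately show False using max[of w] by simp
  qed
  then show ?thesis using e assms by (auto simp: transitive_reduction_def)
qed

text \<open>Sorting by down-set size, which grows strictly along the order, yields a linear
  extension.\<close>

lemma exists_topological_list:
  assumes "X \<subseteq> carrier L"
  shows "\<exists>xs. set xs = X \<and> length xs = card X \<and> (\<forall>as z bs. xs = as @ z # bs \<longrightarrow> (\<forall>u\<in>set as. \<not> z \<sqsubseteq> u))"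
proof -
  let ?f = "\<lambda>e. card {u \<in> carrier L. u \<sqsubseteq> e}"
  obtain ys where ys: "set ys = X" "distinct ys"
    using assms finite_carrier finite_distinct_list finite_subset by metis
  let ?xs = "sort_key ?f ys"
  have "\<not> z \<sqsubseteq> u" if xs: "?xs = as @ z # bs" and u: "u \<in> set as" for as z bs u
  proof
    assume le: "z \<sqsubseteq> u"
    have "distinct ?xs" "set ?xs = X" using ys by simp_all
    then have "z \<noteq> u" "z \<in> carrier L" "u \<in> carrier L" using assms u unfolding xs by auto
    then have "?f z < ?f u" using card_down_less[of z u] le by blast
    moreover have "sorted (map ?f ?xs)" by simp
    then have "?f u \<le> ?f z" using u unfolding xs by (auto simp: sorted_append)
    ultimately show False by simp
  qed
  moreover have "set ?xs = X" "length ?xs = card X" using ys by (simp_all add: distinct_card[symmetric])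
  ultimately show ?thesis by blast
qed

section \<open>Decomposition into blocks\<close>

definition block_decomposition ::
  "nat \<Rightarrow> 'a set \<Rightarrow> (nat \<Rightarrow> 'a) \<Rightarrow> ('a \<Rightarrow> nat) \<Rightarrow> nat \<Rightarrow> bool" where
  "block_decomposition k U hdr blk m \<longleftrightarrow>
     (\<forall>i<m. hdr i \<in> U) \<and>
     (\<forall>x\<in>U. blk x < m \<and> x \<sqsubseteq> hdr (blk x)) \<and>
     (\<forall>x\<in>U. \<forall>i<m. x \<sqsubseteq> hdr i \<longrightarrow> blk x \<le> i) \<and>
     (\<forall>e\<in>U. e \<noteq> hdr (blk e) \<longrightarrow> card {u \<in> U. u \<sqsubseteq> e \<and> blk u = blk e} < k)"

text \<open>Induction peels one block off an up-closed remainder, which keeps the top as long as it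
  is nonempty. Every block except the last has at least \<open>k\<close> elements, whence the bound
  on \<open>m - 1\<close>.\<close>

lemma exists_block_decomposition:
  assumes top: "greatest L t (carrier L)"
    and "U \<subseteq> carrier L" and up: "\<And>x y. \<lbrakk>x \<in> U; y \<in> carrier L; x \<sqsubseteq> y\<rbrakk> \<Longrightarrow> y \<in> U"
  shows "\<exists>hdr blk m. block_decomposition k U hdr blk m \<and> (m - 1) * k \<le> card U"
  using assms(2-)
proof (induction "card U" arbitrary: U rule: less_induct)
  case less
  show ?case
  proof (cases "U = {}")
    case True
    then have "block_decomposition k U (\<lambda>_. t) (\<lambda>_. 0) 0" by (simp add: block_decomposition_def)
    then show ?thesis by fastforce
  next
    case False
    have t: "t \<in> carrier L" "\<And>x. x \<in> carrier L \<Longrightarrow> x \<sqsubseteq> t"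
      using top by (auto simp: greatest_def)
    obtain x0 where "x0 \<in> U" using False by blast
    have "t \<in> U"
      using less.prems(2)[OF \<open>x0 \<in> U\<close> t(1)] t(2) \<open>x0 \<in> U\<close> less.prems(1) by blast
    let ?down = "\<lambda>e. {u \<in> U. u \<sqsubseteq> e}"
    let ?X = "{e \<in> U. k \<le> card (?down e) \<or> e = t}"
    obtain h where h: "h \<in> ?X" and min: "\<forall>u\<in>?X. u \<sqsubseteq> h \<longrightarrow> u = h"
    proof -
      have "?X \<subseteq> carrier L" "?X \<noteq> {}" using less.prems(1) \<open>t \<in> U\<close> by auto
      then show thesis using exists_minimal that by blast
    qed
    have finU: "finite U" using less.prems(1) finite_carrier by (rule finite_subset)
    define U' where "U' = {u \<in> U. \<not> u \<sqsubseteq> h}"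
    have "h \<in> carrier L" using h less.prems(1) by auto
    have "U' \<subset> U" using h \<open>h \<in> carrier L\<close> by (auto simp: U'_def)
    then have "card U' < card U" using finU by (intro psubset_card_mono)
    moreover have "U' \<subseteq> carrier L" using less.prems(1) by (auto simp: U'_def)
    moreover have "y \<in> U'" if "x \<in> U'" "y \<in> carrier L" "x \<sqsubseteq> y" for x y
    proof -
      have x: "x \<in> U" "\<not> x \<sqsubseteq> h" "x \<in> carrier L"
        using that(1) less.prems(1) by (auto simp: U'_def)
      have "y \<in> U" using x(1) that(2,3) by (rule less.prems(2))
      moreover have "\<not> y \<sqsubseteq> h"
        using le_trans[of x y h] that(2,3) x \<open>h \<in> carrier L\<close> by blast
      ultimately show ?thesis by (simp add: U'_def)
    qed
    ultimately have "\<exists>hdr blk m. block_decomposition k U' hdr blk m \<and> (m - 1) * k \<le> card U'"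
      by (rule less.hyps)
    then obtain hdr blk m where dec: "block_decomposition k U' hdr blk m" and
      size: "(m - 1) * k \<le> card U'" by blast
    from dec have hdr: "\<forall>i<m. hdr i \<in> U'" and
      blk: "\<forall>x\<in>U'. blk x < m \<and> x \<sqsubseteq> hdr (blk x)" and
      first: "\<forall>x\<in>U'. \<forall>i<m. x \<sqsubseteq> hdr i \<longrightarrow> blk x \<le> i" and
      small: "\<forall>e\<in>U'. e \<noteq> hdr (blk e) \<longrightarrow> card {u \<in> U'. u \<sqsubseteq> e \<and> blk u = blk e} < k"
      by (simp_all add: block_decomposition_def)
    define hdr' where "hdr' = case_nat h hdr"
    define blk' where "blk' x = (if x \<sqsubseteq> h then 0 else Suc (blk x))" for x
    have "(Suc m - 1) * k \<le> card U"
    proof (cases "m = 0")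
      case m: False
      \<comment> \<open>If further blocks follow, \<open>h\<close> is not the top, so it was chosen
        for its large down-set.\<close>
      have "h \<noteq> t"
      proof
        assume "h = t"
        then have "U' = {}" using t less.prems(1) by (auto simp: U'_def)
        then show False using hdr m by blast
      qed
      then have "k \<le> card (?down h)" using h by simp
      moreover have "card (U' \<union> ?down h) = card U' + card (?down h)"
        by (rule card_Un_disjoint) (use finU in \<open>auto simp: U'_def\<close>)
      moreover have "U' \<union> ?down h = U" by (auto simp: U'_def)
      moreover obtain m' where "m = Suc m'" using m not0_implies_Suc by blast
      ultimately show ?thesis using size by simp
    qed simp
    moreover have "\<forall>i<Suc m. hdr' i \<in> U"
      using hdr h by (auto simp: hdr'_def U'_def split: nat.split)
    moreover have "\<forall>x\<in>U. blk' x < Suc m \<and> x \<sqsubseteq> hdr' (blk' x)"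
      using blk by (auto simp: hdr'_def blk'_def U'_def)
    moreover have "\<forall>x\<in>U. \<forall>i<Suc m. x \<sqsubseteq> hdr' i \<longrightarrow> blk' x \<le> i"
      using first by (auto simp: hdr'_def blk'_def U'_def split: nat.splits)
    moreover have "card {u \<in> U. u \<sqsubseteq> e \<and> blk' u = blk' e} < k"
      if e: "e \<in> U" "e \<noteq> hdr' (blk' e)" for e
    proof (cases "e \<sqsubseteq> h")
      \<comment> \<open>In the new block, minimality of \<open>h\<close> bounds the down-set of
        every other element.\<close>
      case True
      then have "e \<noteq> h" using e by (auto simp: hdr'_def blk'_def)
      then have "e \<notin> ?X" using min True by blast
      then have "card (?down e) < k" using e by simp
      moreover have "card {u \<in> U. u \<sqsubseteq> e \<and> blk' u = blk' e} \<le> card (?down e)"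
        using finU by (intro card_mono) auto
      ultimately show ?thesis by simp
    next
      case False
      have "{u \<in> U. u \<sqsubseteq> e \<and> blk' u = blk' e} = {u \<in> U'. u \<sqsubseteq> e \<and> blk u = blk e}"
        using False by (auto simp: blk'_def U'_def)
      then show ?thesis using small e False by (auto simp: hdr'_def blk'_def U'_def)
    qed
    ultimately have "block_decomposition k U hdr' blk' (Suc m) \<and> (Suc m - 1) * k \<le> card U"
      unfolding block_decomposition_def by (intro conjI ballI impI) simp_all
    then show ?thesis by blast
  qed
qed

end

section \<open>Decision trees and the order oracle\<close>

text \<open>The accumulator keeps the last accepted candidate, so a scan that accepts nothing falls
  back on the candidate one level up.\<close>

fun search :: "('a \<Rightarrow> bool) \<Rightarrow> 'a \<Rightarrow> 'a tree \<Rightarrow> 'a" where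
  "search P c Leaf = c"
| "search P c (Node l a r) = (if P a then search P a l else search P c r)"

fun probes :: "('a \<Rightarrow> bool) \<Rightarrow> 'a tree \<Rightarrow> nat" where
  "probes P Leaf = 0"
| "probes P (Node l a r) = Suc (if P a then probes P l else probes P r)"

text \<open>A linear scan laid out as a right spine: the first accepted entry hands over to its own
  subtree.\<close>

fun chain :: "('b \<Rightarrow> 'a) \<Rightarrow> ('b \<Rightarrow> 'a tree) \<Rightarrow> 'b list \<Rightarrow> 'a tree" where
  "chain val sub [] = Leaf"
| "chain val sub (i # xs) = Node (sub i) (val i) (chain val sub xs)"

lemma chain_hit:
  assumes "\<forall>j\<in>set xs. \<not> P (val j)" "P (val i)"
  shows "search P c (chain val sub (xs @ i # ys)) = search P (val i) (sub i)"
    and "probes P (chain val sub (xs @ i # ys)) = Suc (length xs + probes P (sub i))"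
  using assms by (induction xs) auto

lemma chain_miss:
  assumes "\<forall>j\<in>set xs. \<not> P (val j)"
  shows "search P c (chain val sub xs) = c" and "probes P (chain val sub xs) = length xs"
  using assms by (induction xs) auto

lemma set_tree_chain: "set_tree (chain val sub xs) = val ` set xs \<union> (\<Union>i\<in>set xs. set_tree (sub i))"
  by (induction xs) auto

lemma size_chain_le:
  assumes "\<And>i. i \<in> set xs \<Longrightarrow> Suc (size (sub i)) \<le> b i"
  shows "size (chain val sub xs) \<le> (\<Sum>i\<leftarrow>xs. b i)"
  using assms
proof (induction xs)
  case (Cons a xs)
  then have "Suc (size (sub a)) \<le> b a" "size (chain val sub xs) \<le> (\<Sum>i\<leftarrow>xs. b i)" by simp_all
  then show ?case by simp
qed simp

context partial_lattice
begin

text \<open>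
  The part of a block below its header is the whole block, hence too large to be stored, but a
  query about it is always answered positively. Headers therefore stand for the empty set, which
  an oracle also needs.
\<close>

definition block_part :: "(nat \<Rightarrow> 'a) \<Rightarrow> ('a \<Rightarrow> nat) \<Rightarrow> 'a \<Rightarrow> 'a set" where
  "block_part hdr blk q =
     (if q = hdr (blk q) then {} else {u \<in> carrier L. u \<sqsubseteq> q \<and> blk u = blk q})"

text \<open>The greatest element of block \<open>j\<close> below \<open>z\<close> decides the test.
  If it is the header, the whole block is below \<open>z\<close>, encoded by
  \<open>None\<close>.\<close>

lemma exists_block_oracle:
  assumes dec: "block_decomposition k (carrier L) hdr blk m"
    and z: "z \<in> carrier L" and j: "j < m"
  shows "\<exists>\<psi>. (\<forall>q. \<psi> = Some q \<longrightarrow> q \<in> carrier L) \<and>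
    (\<forall>x\<in>carrier L. blk x = j \<longrightarrow> (x \<sqsubseteq> z \<longleftrightarrow> (case \<psi> of None \<Rightarrow> True | Some q \<Rightarrow> x \<in> block_part hdr blk q)))"
proof -
  have hdr: "hdr j \<in> carrier L" and
    blk: "\<And>x. x \<in> carrier L \<Longrightarrow> blk x < m \<and> x \<sqsubseteq> hdr (blk x)" and
    first: "\<And>x i. x \<in> carrier L \<Longrightarrow> i < m \<Longrightarrow> x \<sqsubseteq> hdr i \<Longrightarrow> blk x \<le> i"
    using dec j by (auto simp: block_decomposition_def)
  have hdr_carrier: "hdr (blk x) \<in> carrier L" if "x \<in> carrier L" for x
    using dec that by (auto simp: block_decomposition_def)
  have mono: "blk u \<le> blk v" if "u \<in> carrier L" "v \<in> carrier L" "u \<sqsubseteq> v" for u v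
    using first[OF that(1), of "blk v"] blk[OF that(2)] le_trans[of u v "hdr (blk v)"] that
      hdr_carrier[OF that(2)] by blast
  let ?X = "{x \<in> carrier L. x \<sqsubseteq> z \<and> blk x = j}"
  show ?thesis
  proof (cases "?X = {}")
    case True
    \<comment> \<open>If \<open>blk (hdr j) = j\<close>, the part is empty; otherwise its members
      lie in a block other than \<open>j\<close>.\<close>
    have "x \<notin> block_part hdr blk (hdr j)" if "blk x = j" for x
      using that by (auto simp: block_part_def)
    then show ?thesis using True hdr by (intro exI[of _ "Some (hdr j)"]) auto
  next
    case False
    have "\<exists>p\<in>?X. \<forall>u\<in>?X. u \<sqsubseteq> p"
    proof (rule exists_greatest_if_directed)
      fix a b assume a: "a \<in> ?X" and b: "b \<in> ?X"
      then have le: "a \<sqsubseteq> hdr j" "b \<sqsubseteq> hdr j" using blk[of a] blk[of b] by auto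
      obtain c where c: "c \<in> carrier L" "a \<sqsubseteq> c" "b \<sqsubseteq> c" "c \<sqsubseteq> z" "c \<sqsubseteq> hdr j"
        using weak_interpolation[of a b z "hdr j"] a b le z hdr by auto
      \<comment> \<open>The interpolant stays in block \<open>j\<close>: it is below
        \<open>hdr j\<close> and above \<open>a\<close>, and \<open>blk\<close> is monotone.\<close>
      have "blk c \<le> j" using first[OF c(1) j c(5)] .
      moreover have "j \<le> blk c" using mono[of a c] a c by auto
      ultimately show "\<exists>c\<in>?X. a \<sqsubseteq> c \<and> b \<sqsubseteq> c" using c by auto
    qed (use False in auto)
    then obtain p where p: "p \<in> carrier L" "p \<sqsubseteq> z" "blk p = j" and
      max: "\<And>u. \<lbrakk>u \<in> carrier L; u \<sqsubseteq> z; blk u = j\<rbrakk> \<Longrightarrow> u \<sqsubseteq> p" by auto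
    have iff: "x \<sqsubseteq> z \<longleftrightarrow> x \<sqsubseteq> p" if "x \<in> carrier L" "blk x = j" for x
      using max[OF that(1) _ that(2)] le_trans[of x p z] p(1,2) z that(1) by blast
    show ?thesis
    proof (cases "p = hdr j")
      case True
      then have "x \<sqsubseteq> z" if "x \<in> carrier L" "blk x = j" for x
        using iff[OF that] blk[OF that(1)] that by simp
      then show ?thesis by (intro exI[of _ None]) auto
    next
      case False
      then have "x \<sqsubseteq> z \<longleftrightarrow> x \<in> block_part hdr blk p" if "x \<in> carrier L" "blk x = j" for x
        using iff[OF that] that p by (simp add: block_part_def)
      then show ?thesis using p by (intro exI[of _ "Some p"]) auto
    qed
  qed
qed

text \<open>\<open>P\<close> abstracts being an upper bound of two query elements; when
  \<open>z\<close> is their join, this means \<open>z \<sqsubseteq> u\<close>. Because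
  \<open>P\<close> is quantified after \<open>T\<close>, one tree serves all queries.\<close>

lemma exists_search_tree:
  assumes dec: "block_decomposition k (carrier L) hdr blk m" and "k > 0"
  shows "\<exists>T. set_tree T \<subseteq> carrier L \<and> size T \<le> m + card (carrier L) * k \<and>
    (\<forall>z\<in>carrier L. \<forall>P c. (\<forall>u\<in>carrier L. P u \<longleftrightarrow> z \<sqsubseteq> u) \<longrightarrow>
       search P c T = z \<and> probes P T \<le> m + max_degree L + k)"
proof -
  have hdr: "\<And>i. i < m \<Longrightarrow> hdr i \<in> carrier L" and
    blk: "\<And>x. x \<in> carrier L \<Longrightarrow> blk x < m \<and> x \<sqsubseteq> hdr (blk x)" and
    first: "\<And>x i. x \<in> carrier L \<Longrightarrow> i < m \<Longrightarrow> x \<sqsubseteq> hdr i \<Longrightarrow> blk x \<le> i" and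
    small: "\<And>e. e \<in> carrier L \<Longrightarrow> e \<noteq> hdr (blk e) \<Longrightarrow>
      card {u \<in> carrier L. u \<sqsubseteq> e \<and> blk u = blk e} < k"
    using dec by (auto simp: block_decomposition_def)
  have "\<forall>X. \<exists>xs. X \<subseteq> carrier L \<longrightarrow> set xs = X \<and> length xs = card X \<and>
      (\<forall>as z bs. xs = as @ z # bs \<longrightarrow> (\<forall>u\<in>set as. \<not> z \<sqsubseteq> u))"
    using exists_topological_list by blast
  from choice[OF this] obtain lst where lst: "\<forall>X. X \<subseteq> carrier L \<longrightarrow>
      set (lst X) = X \<and> length (lst X) = card X \<and>
      (\<forall>as z bs. lst X = as @ z # bs \<longrightarrow> (\<forall>u\<in>set as. \<not> z \<sqsubseteq> u))" ..
  define D where "D e = {u \<in> carrier L. u \<sqsubseteq> e \<and> blk u = blk e}" for e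
  \<comment> \<open>Keeping only children in block \<open>i\<close> makes the sets
    \<open>C i\<close> disjoint, so the third-level scans have total size at most
    \<open>card (carrier L) * k\<close>.\<close>
  define C where "C i = {e \<in> carrier L. (e, hdr i) \<in> transitive_reduction L \<and> blk e = i}" for i
  have sub: "D e \<subseteq> carrier L" "C i \<subseteq> carrier L" for e i by (auto simp: D_def C_def)
  have lstD: "set (lst (D e)) = D e" "length (lst (D e)) = card (D e)"
    and topo: "lst (D e) = as @ z # bs \<Longrightarrow> u \<in> set as \<Longrightarrow> \<not> z \<sqsubseteq> u" for e as z bs u
    using lst[rule_format, OF sub(1)] by blast+
  have lstC: "set (lst (C i)) = C i" "length (lst (C i)) = card (C i)" for i
    using lst[rule_format, OF sub(2)] by simp_all
  have fin: "finite (C i)" for i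
    using sub(2) finite_carrier by (rule finite_subset)
  define T3 where "T3 e = chain (\<lambda>u. u) (\<lambda>_. Leaf) (lst (D e))" for e
  define T2 where "T2 i = chain (\<lambda>e. e) T3 (lst (C i))" for i
  define T where "T = chain hdr T2 [0..<m]"
  have cardD: "card (D e) < k" if "e \<in> C i" for e i
  proof -
    have "e \<noteq> hdr (blk e)" using that by (auto simp: C_def transitive_reduction_def lless_iff)
    then show ?thesis using small[of e] that unfolding D_def by (simp add: C_def)
  qed
  have cardC: "card (C i) \<le> max_degree L" if "i < m" for i
  proof -
    have "card (C i) \<le> degree L (hdr i)" unfolding degree_def
      using finite_carrier
      by (intro card_mono) (auto simp: C_def transitive_reduction_def)
    also have "\<dots> \<le> max_degree L" unfolding max_degree_def
      using finite_carrier hdr[OF that] by (intro Max_ge) auto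
    finally show ?thesis .
  qed
  have set3: "set_tree (T3 e) \<subseteq> carrier L" for e
    using sub(1)[of e] by (simp add: T3_def set_tree_chain lstD)
  have set2: "set_tree (T2 i) \<subseteq> carrier L" for i
    using sub(2)[of i] set3 by (auto simp: T2_def set_tree_chain lstC)
  have "set_tree T \<subseteq> carrier L"
    using set2 hdr unfolding T_def set_tree_chain by auto
  moreover have "size T \<le> m + card (carrier L) * k"
  proof -
    have size3: "Suc (size (T3 e)) \<le> k" if "e \<in> C i" for e i
    proof -
      have "size (T3 e) \<le> (\<Sum>u\<leftarrow>lst (D e). 1)"
        unfolding T3_def by (rule size_chain_le) simp
      then show ?thesis using cardD[OF that] by (simp add: sum_list_triv lstD)
    qed
    have size2: "Suc (size (T2 i)) \<le> Suc (card (C i) * k)" for i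
    proof -
      have "size (T2 i) \<le> (\<Sum>e\<leftarrow>lst (C i). k)"
        unfolding T2_def by (rule size_chain_le) (use size3 lstC in auto)
      then show ?thesis by (simp add: sum_list_triv lstC)
    qed
    have "size T \<le> (\<Sum>i\<leftarrow>[0..<m]. Suc (card (C i) * k))"
      unfolding T_def using size2 by (rule size_chain_le)
    also have "\<dots> = (\<Sum>i<m. Suc (card (C i) * k))"
      by (simp add: sum_list_distinct_conv_sum_set atLeast0LessThan)
    also have "\<dots> = m + (\<Sum>i<m. card (C i)) * k"
      by (simp add: sum_Suc sum_distrib_right)
    also have "(\<Sum>i<m. card (C i)) = card (\<Union>i<m. C i)"
      using fin by (subst card_UN_disjoint) (auto simp: C_def)
    also have "card (\<Union>i<m. C i) \<le> card (carrier L)"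
      using finite_carrier by (intro card_mono) (auto simp: C_def)
    finally show ?thesis by simp
  qed
  moreover have "search P c T = z \<and> probes P T \<le> m + max_degree L + k"
    if z: "z \<in> carrier L" and P: "\<forall>u\<in>carrier L. P u \<longleftrightarrow> z \<sqsubseteq> u" for z P c
  proof -
    define i where "i = blk z"
    have i: "i < m" "z \<sqsubseteq> hdr i" using blk[OF z] by (auto simp: i_def)
    \<comment> \<open>No header before block \<open>i\<close> is above \<open>z\<close>, so the
      first scan stops exactly at \<open>hdr i\<close>.\<close>
    have "\<not> P (hdr j)" if "j < i" for j
      using P hdr[of j] first[OF z, of j] that i by (auto simp: i_def)
    moreover have "P (hdr i)" using P hdr i by blast
    moreover have "[0..<m] = [0..<i] @ i # [Suc i..<m]"
      using i(1) upt_add_eq_append[of 0 i "m - i"] upt_conv_Cons[OF i(1)] by simp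
    ultimately have 1: "search P c T = search P (hdr i) (T2 i)"
      "probes P T = Suc (i + probes P (T2 i))"
      unfolding T_def using chain_hit(1)[of "[0..<i]" P hdr i c T2 "[Suc i..<m]"]
        chain_hit(2)[of "[0..<i]" P hdr i T2 "[Suc i..<m]"] by auto
    have "search P (hdr i) (T2 i) = z \<and> probes P (T2 i) \<le> max_degree L + k"
    proof (cases "\<exists>e\<in>set (lst (C i)). P e")
      case True
      then obtain as e bs where split: "lst (C i) = as @ e # bs" and "P e"
        and none: "\<forall>u\<in>set as. \<not> P u"
        using split_list_first_prop[OF True] by blast
      have "e \<in> C i" using lstC(1)[of i] unfolding split by auto
      then have "z \<in> D e" using P \<open>P e\<close> z by (auto simp: C_def D_def i_def)
      then obtain as' bs' where split': "lst (D e) = as' @ z # bs'"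
        using lstD(1)[of e] split_list[of z "lst (D e)"] by auto
      \<comment> \<open>In a linear extension nothing listed before \<open>z\<close> is above
        \<open>z\<close>, so \<open>z\<close> is the first accepted candidate.\<close>
      have none': "\<forall>u\<in>set as'. \<not> P u"
      proof
        fix u assume "u \<in> set as'"
        moreover from this have "u \<in> carrier L"
          using sub(1)[of e] lstD(1)[of e] unfolding split' by auto
        ultimately show "\<not> P u" using topo[OF split'] P by blast
      qed
      have "P z" using P z by auto
      have "search P e (T3 e) = z" "probes P (T3 e) = Suc (length as')"
        unfolding T3_def split'
        using none' \<open>P z\<close> by (simp_all add: chain_hit)
      moreover have "Suc (length as') \<le> k"
        using lstD(2)[of e] cardD[OF \<open>e \<in> C i\<close>] unfolding split' by simp
      moreover have "Suc (length as) \<le> max_degree L"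
        using lstC(2)[of i] cardC[OF i(1)] unfolding split by simp
      ultimately show ?thesis
        unfolding T2_def split using none \<open>P e\<close> by (simp add: chain_hit)
    next
      case False
      \<comment> \<open>Otherwise some \<open>e\<close> covered by \<open>hdr i\<close> is above
        \<open>z\<close>. Its block index is at most \<open>i\<close> as \<open>e\<close> is below
        \<open>hdr i\<close>, and at least \<open>i\<close> as \<open>e\<close> is above
        \<open>z\<close>, so the child scan would have accepted it.\<close>
      have "z = hdr i"
      proof (rule ccontr)
        assume "z \<noteq> hdr i"
        then obtain e where e: "e \<in> carrier L" "z \<sqsubseteq> e" "(e, hdr i) \<in> transitive_reduction L"
          using exists_cover_above[OF z hdr[OF i(1)]] i(2) by (auto simp: lless_iff)
        have "e \<sqsubseteq> hdr i" using e(3) by (auto simp: transitive_reduction_def lless_iff)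
        then have "blk e \<le> i" using first e(1) i(1) by blast
        moreover have "i \<le> blk e" unfolding i_def
          using first[OF z, of "blk e"] blk[OF e(1)] le_trans[of z e "hdr (blk e)"] hdr[of "blk e"]
            e(1,2) z by blast
        ultimately have "e \<in> C i" using e by (simp add: C_def)
        then show False using False P e lstC(1)[of i] by auto
      qed
      moreover have "search P (hdr i) (T2 i) = hdr i" "probes P (T2 i) = card (C i)"
        unfolding T2_def using False by (simp_all add: chain_miss lstC)
      ultimately show ?thesis using cardC[OF i(1)] by simp
    qed
    then show ?thesis using 1 i(1) by simp
  qed
  ultimately show ?thesis by blast
qed

end

section \<open>The query program\<close>

text \<open>Jump targets are absolute, so the code gets its own position \<open>pos\<close>; success
  leaves at \<open>pos + 13\<close>, just past its 13 instructions. After the oracle entry, three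
  loads follow the double displacement, with offsets relative to the start of the table.\<close>

definition order_test :: "nat \<Rightarrow> nat \<Rightarrow> nat \<Rightarrow> nat \<Rightarrow> nat \<Rightarrow> nat \<Rightarrow> program" where
  "order_test pos b u v x miss =
    [Op WAdd 20 15 b, Load 20 20, JumpEq 20 3 (pos + 13),
     Op WAdd 21 20 v, Load 21 21,
     Op WAdd 21 21 u, Op WAdd 21 21 20, Load 21 21,
     Op WAdd 21 21 v, Op WAdd 21 21 20, Load 21 21,
     JumpEq 21 x (pos + 13), Jump miss]"

text \<open>
  Registers 1 and 2 hold the query \<open>y\<close> and \<open>x\<close>, register 3 zero, 5 the block size \<open>k\<close>, 6 the row length,
  and 7 the current tree node. Block index, quotient and remainder modulo \<open>k\<close> are in registers
  9, 10, 11 for \<open>x\<close> and 12, 13, 14 for \<open>y\<close>. Register 16 holds the candidate \<open>z\<close> at the node and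
  15 the address of its oracle entries. Positions 18, 52 and 55 are the loop head, the exit for
  candidates that are not upper bounds, and the halting instruction.
\<close>

definition join_program :: program where
  "join_program =
    [Move 2 0, Const 17 1, Const 18 2, Const 8 3, Const 19 4,
     Load 5 3, Load 6 17, Load 7 18,
     Op WDiv 10 2 5, Op WMod 11 2 5, Op WMul 9 2 6, Op WAdd 9 9 8, Load 9 9,
     Op WDiv 13 1 5, Op WMod 14 1 5, Op WMul 12 1 6, Op WAdd 12 12 8, Load 12 12,
     JumpEq 7 3 55, Load 16 7, Op WMul 15 16 6, Op WAdd 15 15 19] @
    order_test 22 9 10 11 2 52 @ order_test 35 12 13 14 1 52 @
    [Move 0 16, Op WAdd 7 7 17, Load 7 7, Jump 18,
     Op WAdd 7 7 18, Load 7 7, Jump 18,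
     Halt]"

lemmas join_program_unfold = join_program_def order_test_def append.simps

section \<open>Symbolic execution of the order test\<close>

lemma steps_numeral:
  "steps w P (numeral t) s = Option.bind (step w P s) (steps w P (pred_numeral t))"
  by (simp add: numeral_eq_Suc)

lemma steps_trans:
  "\<lbrakk>steps w P a s = Some s'; steps w P b s' = Some s''\<rbrakk> \<Longrightarrow> steps w P (a + b) s = Some s''"
proof (induction a arbitrary: s)
  case (Suc a)
  then show ?case by (cases "step w P s") auto
qed simp

text \<open>Three runs are possible: a zero oracle entry ends after 3 steps, a hit after 12 and a
  miss after 13.\<close>

lemma order_test_steps:
  fixes s :: ram_state
  assumes code: "(pos, b, u, v, x) = (22, 9, 10, 11, 2) \<or> (pos, b, u, v, x) = (35, 12, 13, 14, 1)"
    and "pc s = pos" "regs s 3 = 0" "length (mem s) \<le> 2 ^ w"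
    and q: "regs s 15 + regs s b < length (mem s)" "mem s ! (regs s 15 + regs s b) = q"
    and table: "q \<noteq> 0 \<Longrightarrow> q + regs s v < length (mem s) \<and> mem s ! (q + regs s v) = e1 \<and>
      e1 + regs s u + q < length (mem s) \<and> mem s ! (e1 + regs s u + q) = e2 \<and>
      e2 + regs s v + q < length (mem s) \<and> mem s ! (e2 + regs s v + q) = e3"
  shows "\<exists>t s'. t \<le> 13 \<and> steps w join_program t s = Some s' \<and>
    pc s' = (if q = 0 \<or> e3 = regs s x then pos + 13 else 52) \<and>
    mem s' = mem s \<and> (\<forall>r. r \<noteq> 20 \<longrightarrow> r \<noteq> 21 \<longrightarrow> regs s' r = regs s r)"
proof (cases "q = 0")
  case True
  have "\<exists>s'. steps w join_program 3 s = Some s' \<and> pc s' = pos + 13 \<and>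
    mem s' = mem s \<and> (\<forall>r. r \<noteq> 20 \<longrightarrow> r \<noteq> 21 \<longrightarrow> regs s' r = regs s r)"
    using assms(2-6) True code
    by (elim disjE) (simp_all add: steps_numeral step_def join_program_unfold take_bit_nat_eq_self)
  then show ?thesis using True by (intro exI[of _ 3]) auto
next
  case False
  note t = table[OF False]
  \<comment> \<open>Every sum, including the intermediate ones, is below the memory length, so
    addition modulo \<open>2 ^ w\<close> is exact.\<close>
  have bounds: "regs s 15 + regs s b < 2 ^ w" "q + regs s v < 2 ^ w"
    "e1 + regs s u < 2 ^ w" "e1 + regs s u + q < 2 ^ w"
    "e2 + regs s v < 2 ^ w" "e2 + regs s v + q < 2 ^ w"
    using t assms(4) q(1) by linarith+
  show ?thesis
  proof (cases "e3 = regs s x")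
    case True
    have "\<exists>s'. steps w join_program 12 s = Some s' \<and> pc s' = pos + 13 \<and>
      mem s' = mem s \<and> (\<forall>r. r \<noteq> 20 \<longrightarrow> r \<noteq> 21 \<longrightarrow> regs s' r = regs s r)"
      using assms(2,3) q t bounds True False code
      by (elim disjE) (simp_all add: steps_numeral step_def join_program_unfold take_bit_nat_eq_self)
    then show ?thesis using True by (intro exI[of _ 12]) auto
  next
    case neq: False
    have "\<exists>s'. steps w join_program 13 s = Some s' \<and> pc s' = 52 \<and>
      mem s' = mem s \<and> (\<forall>r. r \<noteq> 20 \<longrightarrow> r \<noteq> 21 \<longrightarrow> regs s' r = regs s r)"
      using assms(2,3) q t bounds neq False code
      by (elim disjE) (simp_all add: steps_numeral step_def join_program_unfold take_bit_nat_eq_self)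
    then show ?thesis using neq False by (intro exI[of _ 13]) auto
  qed
qed

text \<open>Address 0 serves as the null pointer; the cell there belongs to the header of the
  memory.\<close>

fun tree_at :: "nat list \<Rightarrow> nat \<Rightarrow> nat tree \<Rightarrow> bool" where
  "tree_at M p Leaf \<longleftrightarrow> p = 0"
| "tree_at M p (Node l z r) \<longleftrightarrow> 0 < p \<and> p + 2 < length M \<and> M ! p = z \<and>
     tree_at M (M ! (p + 1)) l \<and> tree_at M (M ! (p + 2)) r"

text \<open>
  Row \<open>z\<close> starts at \<open>z * R + 3\<close> with the block index of \<open>z\<close>, followed by one oracle entry per block:
  zero if the whole block is below \<open>z\<close>, otherwise the address of a membership table.
\<close>

locale join_memory =
  fixes w n k R root :: nat and M :: "nat list" and T :: "nat tree" and le :: "nat \<Rightarrow> nat \<Rightarrow> bool"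
  assumes words: "length M \<le> 2 ^ w" "n \<le> 2 ^ w" "4 < length M"
    and header: "M ! 0 = k" "M ! 1 = R" "M ! 2 = root"
    and tree: "tree_at M root T" "set_tree T \<subseteq> {..<n}"
    and row: "x < n \<Longrightarrow> x * R + 3 < length M"
    and entry: "\<lbrakk>x < n; z < n\<rbrakk> \<Longrightarrow> z * R + 4 + M ! (x * R + 3) < length M"
    and full: "\<lbrakk>x < n; z < n; M ! (z * R + 4 + M ! (x * R + 3)) = 0\<rbrakk> \<Longrightarrow> le x z"
    and table: "\<lbrakk>x < n; z < n; M ! (z * R + 4 + M ! (x * R + 3)) = q; q \<noteq> 0\<rbrakk> \<Longrightarrow>
      q + x mod k < length M \<and>
      M ! (q + x mod k) + x div k + q < length M \<and>
      M ! (M ! (q + x mod k) + x div k + q) + x mod k + q < length M \<and>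
      (M ! (M ! (M ! (q + x mod k) + x div k + q) + x mod k + q) = x \<longleftrightarrow> le x z)"
begin

text \<open>The loop invariant: what the walk never overwrites. The current node in register 7 and
  the last accepted candidate in register 0 are tracked separately.\<close>

definition loop_state :: "nat \<Rightarrow> nat \<Rightarrow> ram_state \<Rightarrow> bool" where
  "loop_state x y s \<longleftrightarrow> mem s = M \<and> regs s 1 = y \<and> regs s 2 = x \<and> regs s 3 = 0 \<and> regs s 6 = R \<and>
     regs s 9 = M ! (x * R + 3) \<and> regs s 10 = x div k \<and> regs s 11 = x mod k \<and>
     regs s 12 = M ! (y * R + 3) \<and> regs s 13 = y div k \<and> regs s 14 = y mod k \<and>
     regs s 17 = 1 \<and> regs s 18 = 2 \<and> regs s 19 = 4"

lemma order_test_correct: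
  fixes pos b u v x :: nat
  assumes code: "(pos, b, u, v, x) = (22, 9, 10, 11, 2) \<or> (pos, b, u, v, x) = (35, 12, 13, 14, 1)"
    and s: "pc s = pos" "loop_state x0 y0 s" "regs s 15 = z * R + 4"
    and n: "x0 < n" "y0 < n" "z < n"
  shows "\<exists>t s'. t \<le> 13 \<and> steps w join_program t s = Some s' \<and>
    pc s' = (if le (regs s x) z then pos + 13 else 52) \<and>
    loop_state x0 y0 s' \<and> (\<forall>r\<in>{0, 7, 15, 16}. regs s' r = regs s r)"
proof -
  let ?x = "regs s x"
  have x: "?x < n" "regs s b = M ! (?x * R + 3)" "regs s u = ?x div k" "regs s v = ?x mod k"
    using code s n by (auto simp: loop_state_def)
  have mem: "mem s = M" and r3: "regs s 3 = 0" using s by (auto simp: loop_state_def)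
  define q where "q = M ! (z * R + 4 + M ! (?x * R + 3))"
  have q: "regs s 15 + regs s b < length (mem s)" "mem s ! (regs s 15 + regs s b) = q"
    using entry[OF x(1) n(3)] s x mem by (simp_all add: q_def)
  have tab: "q + regs s v < length (mem s) \<and> mem s ! (q + regs s v) = M ! (q + ?x mod k) \<and>
      M ! (q + ?x mod k) + regs s u + q < length (mem s) \<and>
      mem s ! (M ! (q + ?x mod k) + regs s u + q) = M ! (M ! (q + ?x mod k) + ?x div k + q) \<and>
      M ! (M ! (q + ?x mod k) + ?x div k + q) + regs s v + q < length (mem s) \<and>
      mem s ! (M ! (M ! (q + ?x mod k) + ?x div k + q) + regs s v + q) =
        M ! (M ! (M ! (q + ?x mod k) + ?x div k + q) + ?x mod k + q)" if "q \<noteq> 0"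
    using table[OF x(1) n(3) q_def[symmetric] that] unfolding x(3,4) mem by blast
  have le: "q = 0 \<or> M ! (M ! (M ! (q + ?x mod k) + ?x div k + q) + ?x mod k + q) = ?x \<longleftrightarrow> le ?x z"
    using table[OF x(1) n(3) q_def[symmetric]] full[OF x(1) n(3), folded q_def] by blast
  obtain t s' where t: "t \<le> 13" "steps w join_program t s = Some s'"
    "pc s' = (if le ?x z then pos + 13 else 52)"
    "mem s' = mem s" "\<And>r. r \<noteq> 20 \<Longrightarrow> r \<noteq> 21 \<Longrightarrow> regs s' r = regs s r"
    using order_test_steps[OF code s(1) r3 words(1)[folded mem] q tab] unfolding le by blast
  then show ?thesis using s by (intro exI[of _ t] exI[of _ s']) (simp add: loop_state_def)
qed

text \<open>A round costs at most 4 steps to fetch the candidate, 2 * 13 for the tests and 4 to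
  descend, hence 34. The extra step is the jump to the halting instruction at a null
  pointer.\<close>

lemma loop_correct:
  assumes "pc s = 18" "loop_state x y s" "tree_at M (regs s 7) U" "set_tree U \<subseteq> {..<n}"
    and n: "x < n" "y < n"
  defines "P \<equiv> \<lambda>z. le x z \<and> le y z"
  shows "\<exists>t s'. t \<le> 34 * probes P U + 1 \<and> steps w join_program t s = Some s' \<and>
    halted join_program s' \<and> regs s' 0 = search P (regs s 0) U \<and> mem s' = M"
  using assms(1-4)
proof (induction U arbitrary: s)
  case Leaf
  have "\<exists>s'. steps w join_program 1 s = Some s' \<and> pc s' = 55 \<and> regs s' 0 = regs s 0 \<and> mem s' = M"
    using Leaf by (simp add: loop_state_def step_def join_program_unfold)
  then obtain s' where s': "steps w join_program 1 s = Some s'" "pc s' = 55"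
    "regs s' 0 = regs s 0" "mem s' = M" by blast
  have "halted join_program s'" using s'(2) by (simp add: halted_def join_program_unfold)
  then show ?case using s' by (intro exI[of _ 1] exI[of _ s']) simp
next
  case (Node l z r)
  define p where "p = regs s 7"
  have z: "z < n" and p: "0 < p" "p + 2 < length M" "M ! p = z"
    and sub: "tree_at M (M ! (p + 1)) l" "tree_at M (M ! (p + 2)) r"
    "set_tree l \<subseteq> {..<n}" "set_tree r \<subseteq> {..<n}"
    using Node.prems by (auto simp: p_def)
  have bounds: "z * R < 2 ^ w" "z * R + 4 < 2 ^ w" "p < length M" "p + 1 < 2 ^ w" "p + 1 < length M"
    "p + 2 < 2 ^ w" "p + 2 < length M"
    using entry[OF z z] p words by linarith+
  have "\<exists>s1. steps w join_program 4 s = Some s1 \<and> pc s1 = 22 \<and> loop_state x y s1 \<and>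
      regs s1 15 = z * R + 4 \<and> regs s1 16 = z \<and> regs s1 7 = p \<and> regs s1 0 = regs s 0"
    using Node.prems(1,2) p_def[symmetric] p bounds
    by (simp add: loop_state_def steps_numeral step_def join_program_unfold take_bit_nat_eq_self)
  then obtain s1 where s1: "steps w join_program 4 s = Some s1" "pc s1 = 22" "loop_state x y s1"
      "regs s1 15 = z * R + 4" "regs s1 16 = z" "regs s1 7 = p" "regs s1 0 = regs s 0" by blast
  have s1x: "regs s1 2 = x" using s1(3) by (simp add: loop_state_def)
  obtain t2 s2 where s2: "t2 \<le> 13" "steps w join_program t2 s1 = Some s2"
      "pc s2 = (if le x z then 35 else 52)" "loop_state x y s2"
      "regs s2 15 = z * R + 4" "regs s2 16 = z" "regs s2 7 = p" "regs s2 0 = regs s 0"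
    using order_test_correct[of 22 9 10 11 2, OF _ s1(2,3,4) n z] s1 s1x by auto
  have "\<exists>t3 s3. t3 \<le> 26 \<and> steps w join_program t3 s1 = Some s3 \<and>
      pc s3 = (if P z then 48 else 52) \<and> loop_state x y s3 \<and>
      regs s3 16 = z \<and> regs s3 7 = p \<and> regs s3 0 = regs s 0"
  proof (cases "le x z")
    case True
    then have pc2: "pc s2 = 35" using s2 by simp
    have s2y: "regs s2 1 = y" using s2(4) by (simp add: loop_state_def)
    obtain t3 s3 where s3: "t3 \<le> 13" "steps w join_program t3 s2 = Some s3"
      "pc s3 = (if le y z then 48 else 52)" "loop_state x y s3"
      "regs s3 16 = z" "regs s3 7 = p" "regs s3 0 = regs s 0"
      using order_test_correct[of 35 12 13 14 1, OF _ pc2 s2(4,5) n z] s2 s2y by auto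
    then show ?thesis using steps_trans[OF s2(2) s3(2)] True s2(1)
      by (intro exI[of _ "t2 + t3"] exI[of _ s3]) (simp add: P_def)
  next
    case False
    then show ?thesis using s2 by (intro exI[of _ t2] exI[of _ s2]) (simp add: P_def)
  qed
  then obtain t3 s3 where s3: "t3 \<le> 26" "steps w join_program t3 s1 = Some s3"
      "pc s3 = (if P z then 48 else 52)" "loop_state x y s3"
      "regs s3 16 = z" "regs s3 7 = p" "regs s3 0 = regs s 0" by blast
  show ?case
  proof (cases "P z")
    case True
    have "\<exists>s4. steps w join_program 4 s3 = Some s4 \<and> pc s4 = 18 \<and> loop_state x y s4 \<and>
      regs s4 7 = M ! (p + 1) \<and> regs s4 0 = z"
      using s3(3-) True bounds
      by (simp add: loop_state_def steps_numeral step_def join_program_unfold take_bit_nat_eq_self)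
    then obtain s4 where s4: "steps w join_program 4 s3 = Some s4" "pc s4 = 18" "loop_state x y s4"
      "regs s4 7 = M ! (p + 1)" "regs s4 0 = z" by blast
    obtain t5 s5 where s5: "t5 \<le> 34 * probes P l + 1" "steps w join_program t5 s4 = Some s5"
      "halted join_program s5" "regs s5 0 = search P z l" "mem s5 = M"
      using Node.IH(1)[OF s4(2,3) _ sub(3)] sub(1) s4(4,5) by auto
    have "steps w join_program (((4 + t3) + 4) + t5) s = Some s5"
      by (intro steps_trans[of _ _ _ s s4] steps_trans[of _ _ _ s s3] steps_trans[of _ _ _ s s1]) fact+
    then show ?thesis using s5 s3(1) True
      by (intro exI[of _ "((4 + t3) + 4) + t5"] exI[of _ s5]) simp
  next
    case False
    have "\<exists>s4. steps w join_program 3 s3 = Some s4 \<and> pc s4 = 18 \<and> loop_state x y s4 \<and>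
      regs s4 7 = M ! (p + 2) \<and> regs s4 0 = regs s 0"
      using s3(3-) False bounds
      by (simp add: loop_state_def steps_numeral step_def join_program_unfold take_bit_nat_eq_self)
    then obtain s4 where s4: "steps w join_program 3 s3 = Some s4" "pc s4 = 18" "loop_state x y s4"
      "regs s4 7 = M ! (p + 2)" "regs s4 0 = regs s 0" by blast
    obtain t5 s5 where s5: "t5 \<le> 34 * probes P r + 1" "steps w join_program t5 s4 = Some s5"
      "halted join_program s5" "regs s5 0 = search P (regs s 0) r" "mem s5 = M"
      using Node.IH(2)[OF s4(2,3) _ sub(4)] sub(2) s4(4,5) by auto
    have "steps w join_program (((4 + t3) + 3) + t5) s = Some s5"
      by (intro steps_trans[of _ _ _ s s4] steps_trans[of _ _ _ s s3] steps_trans[of _ _ _ s s1]) fact+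
    then show ?thesis using s5 s3(1) False
      by (intro exI[of _ "((4 + t3) + 3) + t5"] exI[of _ s5]) simp
  qed
qed

text \<open>The 18 setup steps and the final jump add up to 19. The default \<open>c\<close> is
  whatever register 0 holds on entering the loop.\<close>

lemma join_program_correct:
  assumes n: "x < n" "y < n"
  defines "P \<equiv> \<lambda>z. le x z \<and> le y z"
  shows "\<exists>t\<le>34 * probes P T + 19. \<exists>c. answers_in w join_program M x y (search P c T) t"
proof -
  have bounds: "x * R < 2 ^ w" "x * R + 3 < 2 ^ w" "y * R < 2 ^ w" "y * R + 3 < 2 ^ w"
    "x div k < 2 ^ w" "x mod k < 2 ^ w" "y div k < 2 ^ w" "y mod k < 2 ^ w"
    "1 < (2::nat) ^ w" "2 < (2::nat) ^ w" "3 < (2::nat) ^ w" "4 < (2::nat) ^ w"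
    using row[OF n(1)] row[OF n(2)] words n
      div_le_dividend[of x k] div_le_dividend[of y k] mod_less_eq_dividend[of x k] mod_less_eq_dividend[of y k]
    by linarith+
  \<comment> \<open>The constants of the program, up to 4, must survive truncation to
    \<open>w\<close> bits.\<close>
  have "2 < w"
  proof (rule ccontr)
    assume "\<not> 2 < w"
    then have "(2::nat) ^ w \<le> 2 ^ 2" by (intro power_increasing) auto
    then show False using bounds by simp
  qed
  have len: "0 < length M" "1 < length M" "2 < length M" using words by linarith+
  have "\<exists>s. steps w join_program 18 (query_state M x y) = Some s \<and> pc s = 18 \<and> loop_state x y s \<and>
      regs s 7 = root"
    using \<open>2 < w\<close> bounds len header row[OF n(1)] row[OF n(2)]
    by (simp add: query_state_def loop_state_def steps_numeral step_def join_program_unfold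
        take_bit_nat_eq_self)
  then obtain s where s: "steps w join_program 18 (query_state M x y) = Some s" "pc s = 18"
    "loop_state x y s" "regs s 7 = root" by blast
  obtain t s' where t: "t \<le> 34 * probes P T + 1" "steps w join_program t s = Some s'"
    "halted join_program s'" "regs s' 0 = search P (regs s 0) T" "mem s' = M"
    using loop_correct[OF s(2,3) _ tree(2) n] tree(1) s(4) by (auto simp: P_def)
  show ?thesis
    using steps_trans[OF s(1) t(2)] t unfolding answers_in_def
    by (intro exI[of _ "18 + t"] conjI exI[of _ "regs s 0"] exI[of _ s']) simp_all
qed

end

section \<open>The memory layout\<close>

text \<open>Preorder with three words per node: the left subtree directly follows its root and the
  right one follows after \<open>3 * size l\<close> words. \<open>p\<close> is the absolute base
  address.\<close>

fun layout :: "nat \<Rightarrow> nat tree \<Rightarrow> nat list" where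
  "layout p Leaf = []"
| "layout p (Node l z r) =
     [z, if l = Leaf then 0 else p + 3, if r = Leaf then 0 else p + 3 + 3 * size l] @
     layout (p + 3) l @ layout (p + 3 + 3 * size l) r"

lemma length_layout: "length (layout p T) = 3 * size T"
  by (induction T arbitrary: p) auto

lemma layout_entries: "e \<in> set (layout p T) \<Longrightarrow> e < p + 3 * size T \<or> e \<in> set_tree T"
proof (induction T arbitrary: p)
  case (Node l z r)
  \<comment> \<open>Nonzero pointers lead to nonempty subtrees, which makes the address bound
    strict.\<close>
  have "0 < size l" if "l \<noteq> Leaf" using that by (cases l) auto
  moreover have "0 < size r" if "r \<noteq> Leaf" using that by (cases r) auto
  ultimately show ?case using Node.prems Node.IH by (fastforce split: if_splits)
qed simp

text \<open>A nonempty prefix keeps node addresses apart from the null pointer; arbitrary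
  surroundings \<open>xs\<close> and \<open>ys\<close> let the induction descend into both
  subtrees.\<close>

lemma tree_at_layout:
  assumes "0 < length xs"
  shows "tree_at (xs @ layout (length xs) T @ ys) (if T = Leaf then 0 else length xs) T"
  using assms
proof (induction T arbitrary: xs ys)
  case (Node l z r)
  let ?p = "length xs"
  let ?h = "[z, if l = Leaf then 0 else ?p + 3, if r = Leaf then 0 else ?p + 3 + 3 * size l]"
  let ?M = "xs @ layout ?p (Node l z r) @ ys"
  let ?Ll = "layout (?p + 3) l" and ?Lr = "layout (?p + 3 + 3 * size l) r"
  have len: "length (xs @ ?h) = ?p + 3" "length (xs @ ?h @ ?Ll) = ?p + 3 + 3 * size l"
    by (simp_all add: length_layout)
  have M_l: "?M = (xs @ ?h) @ ?Ll @ (?Lr @ ys)" and M_r: "?M = (xs @ ?h @ ?Ll) @ ?Lr @ ys"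
    by (simp_all only: layout.simps append_assoc)
  have l: "tree_at ?M (if l = Leaf then 0 else ?p + 3) l"
    unfolding M_l using Node.IH(1)[of "xs @ ?h" "?Lr @ ys", unfolded len] by simp
  have r: "tree_at ?M (if r = Leaf then 0 else ?p + 3 + 3 * size l) r"
    unfolding M_r using Node.IH(2)[of "xs @ ?h @ ?Ll" ys, unfolded len] by simp
  have M: "?M ! ?p = z" "?M ! (?p + 1) = (if l = Leaf then 0 else ?p + 3)"
    "?M ! (?p + 2) = (if r = Leaf then 0 else ?p + 3 + 3 * size l)"
    by (simp_all add: nth_append)
  have "?p + 2 < length ?M" by simp
  then have "tree_at ?M ?p (Node l z r)"
    using l r Node.prems unfolding tree_at.simps(2) M by blast
  then show ?case by simp
qed simp

section \<open>Assembling the memory image\<close>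

lemma exists_join_memory:
  fixes L :: "nat gorder" (structure)
  assumes "partial_lattice L" and carrier: "carrier L = {..<n}" and top: "greatest L t (carrier L)"
    and k: "n \<le> k * k" "0 < k" and w: "22 * n * k \<le> 2 ^ w"
  shows "\<exists>M. (\<forall>e\<in>set M. e < 2 ^ w) \<and> length M \<le> 22 * n * k \<and>
    (\<forall>x<n. \<forall>y<n. \<exists>\<tau>\<le>34 * (2 * k + 1 + max_degree L) + 19.
       answers_in w join_program M x y (x \<squnion>\<^bsub>L\<^esub> y) \<tau>)"
proof -
  interpret partial_lattice L by fact
  have "0 < n" using top carrier by (auto simp: greatest_def)
  obtain hdr blk m where dec: "block_decomposition k (carrier L) hdr blk m"
    and m_size: "(m - 1) * k \<le> card (carrier L)"
    using exists_block_decomposition[OF top, of "carrier L" k] by auto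
  have "card (carrier L) = n" using carrier by simp
  \<comment> \<open>At most \<open>k + 1\<close> blocks, so \<open>k + 1\<close> oracle entries per
    row suffice.\<close>
  then have "(m - 1) * k \<le> k * k" using order_trans[OF m_size] k(1) by blast
  then have m: "m \<le> k + 1" using mult_le_cancel2[of "m - 1" k k] \<open>0 < k\<close> by linarith
  have blk: "blk x < m" if "x < n" for x
    using dec that carrier by (simp add: block_decomposition_def)
  define tab where "tab = block_part hdr blk"
  \<comment> \<open>The bound \<open>q < n\<close> is required even for \<open>j \<ge> m\<close>:
    rows have \<open>k + 1\<close> oracle entries whatever \<open>m\<close> is, and all of them must
    fit into words.\<close>
  have "\<exists>\<psi>. z < n \<longrightarrow> (\<forall>q. \<psi> = Some q \<longrightarrow> q < n) \<and> (j < m \<longrightarrow>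
      (\<forall>x<n. blk x = j \<longrightarrow> (x \<sqsubseteq> z \<longleftrightarrow> (case \<psi> of None \<Rightarrow> True | Some q \<Rightarrow> x \<in> tab q))))" for z j
  proof (cases "z < n \<and> j < m")
    case True
    then have "z \<in> carrier L" "j < m" using carrier by simp_all
    from exists_block_oracle[OF dec this, folded tab_def] obtain \<psi> where
      "\<forall>q. \<psi> = Some q \<longrightarrow> q \<in> carrier L"
      "\<forall>x\<in>carrier L. blk x = j \<longrightarrow> (x \<sqsubseteq> z \<longleftrightarrow> (case \<psi> of None \<Rightarrow> True | Some q \<Rightarrow> x \<in> tab q))"
      by (elim exE conjE)
    then show ?thesis by (intro exI[of _ \<psi>]) (simp add: carrier)
  next
    case False
    then show ?thesis by (intro exI[of _ None]) auto
  qed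
  then have "\<forall>z. \<exists>\<psi>. \<forall>j. z < n \<longrightarrow> (\<forall>q. \<psi> j = Some q \<longrightarrow> q < n) \<and> (j < m \<longrightarrow>
      (\<forall>x<n. blk x = j \<longrightarrow> (x \<sqsubseteq> z \<longleftrightarrow> (case \<psi> j of None \<Rightarrow> True | Some q \<Rightarrow> x \<in> tab q))))"
    by (intro allI choice) simp
  from choice[OF this] obtain \<psi> where \<psi>: "\<forall>z j. z < n \<longrightarrow> (\<forall>q. \<psi> z j = Some q \<longrightarrow> q < n) \<and> (j < m \<longrightarrow>
      (\<forall>x<n. blk x = j \<longrightarrow> (x \<sqsubseteq> z \<longleftrightarrow> (case \<psi> z j of None \<Rightarrow> True | Some q \<Rightarrow> x \<in> tab q))))"
 ..
  have \<psi>_less: "q < n" if "z < n" "\<psi> z j = Some q" for z j q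
    using \<psi>[rule_format, of z j] that by blast
  have \<psi>_iff: "x \<sqsubseteq> z \<longleftrightarrow> (case \<psi> z (blk x) of None \<Rightarrow> True | Some q \<Rightarrow> x \<in> tab q)"
    if "z < n" "x < n" for z x
    using \<psi>[rule_format, of z "blk x"] that blk by blast
  have "\<forall>q. \<exists>E. q < n \<longrightarrow> (\<forall>i. E i \<le> 6 * k + n) \<and> (\<forall>x<n.
     E (x mod k) + x div k < 3 * k \<and> E (E (x mod k) + x div k) + x mod k < 7 * k \<and>
     (E (E (E (x mod k) + x div k) + x mod k) = x \<longleftrightarrow> x \<in> tab q))"
  proof (intro allI)
    fix q
    have "card (tab q) \<le> k" "tab q \<subseteq> {..<n}" if "q < n"
      using dec that carrier by (auto simp: tab_def block_part_def block_decomposition_def less_imp_le)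
    then show "\<exists>E. q < n \<longrightarrow> (\<forall>i. E i \<le> 6 * k + n) \<and> (\<forall>x<n.
       E (x mod k) + x div k < 3 * k \<and> E (E (x mod k) + x div k) + x mod k < 7 * k \<and>
       (E (E (E (x mod k) + x div k) + x mod k) = x \<longleftrightarrow> x \<in> tab q))"
      using exists_membership_table[of "tab q" n k] k(1) by blast
  qed
  from choice[OF this] obtain E where E_all: "\<forall>q. q < n \<longrightarrow> (\<forall>i. E q i \<le> 6 * k + n) \<and> (\<forall>x<n.
     E q (x mod k) + x div k < 3 * k \<and> E q (E q (x mod k) + x div k) + x mod k < 7 * k \<and>
     (E q (E q (E q (x mod k) + x div k) + x mod k) = x \<longleftrightarrow> x \<in> tab q))" ..
  have E_le: "E q i \<le> 6 * k + n" if "q < n" for q i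
    using E_all that by blast
  have E: "E q (x mod k) + x div k < 3 * k \<and>
     E q (E q (x mod k) + x div k) + x mod k < 7 * k \<and>
     (E q (E q (E q (x mod k) + x div k) + x mod k) = x \<longleftrightarrow> x \<in> tab q)" if "q < n" "x < n" for q x
    using E_all that by blast
  obtain T where T: "set_tree T \<subseteq> {..<n}" "size T \<le> m + n * k"
    and search: "\<And>z P c. \<lbrakk>z < n; \<forall>u<n. P u \<longleftrightarrow> z \<sqsubseteq> u\<rbrakk> \<Longrightarrow>
       search P c T = z \<and> probes P T \<le> m + max_degree L + k"
    using exists_search_tree[OF dec \<open>0 < k\<close>] carrier by auto
  \<comment> \<open>A row consists of the block index, \<open>k + 1\<close> oracle entries and a
    table of \<open>7 * k\<close> words. The table of row \<open>q\<close> starts at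
    \<open>q * R + 3 + (k + 2)\<close>, which is never zero.\<close>
  define R where "R = 8 * k + 2"
  define cell where "cell z i = (if i = 0 then blk z
     else if i \<le> k + 1 then (case \<psi> z (i - 1) of None \<Rightarrow> 0 | Some q \<Rightarrow> q * R + k + 5)
     else E z (i - (k + 2)))" for z i
  define root where "root = (if T = Leaf then 0 else 3 + n * R)"
  define xs where "xs = [k, R, root] @ map (\<lambda>i. cell (i div R) (i mod R)) [0..<n * R]"
  define M where "M = xs @ layout (length xs) T @ []"
  have xs: "length xs = 3 + n * R" by (simp add: xs_def)
  have lenM: "length M = 3 + n * R + 3 * size T" by (simp add: M_def xs length_layout)
  have addr: "z * R + 3 + i < 3 + n * R" if "z < n" "i < R" for z i
  proof -
    have "z * R + i < Suc z * R" using that by simp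
    also have "\<dots> \<le> n * R" using that by (intro mult_le_mono1) simp
    finally show ?thesis by simp
  qed
  have lookup: "M ! (z * R + 3 + i) = cell z i" "z * R + 3 + i < length M" if "z < n" "i < R" for z i
  proof -
    have "z * R + i < n * R" using addr[OF that] by simp
    moreover have "(z * R + i) div R = z" "(z * R + i) mod R = i" using that by simp_all
    ultimately show "M ! (z * R + 3 + i) = cell z i"
      by (simp add: M_def xs_def nth_append)
    show "z * R + 3 + i < length M" using addr[OF that] lenM by simp
  qed
  have nk: "k \<le> n * k" "n \<le> n * k" "1 \<le> n * k" using \<open>0 < n\<close> \<open>0 < k\<close> by auto
  have nR: "n * R = 8 * (n * k) + 2 * n" by (simp add: R_def algebra_simps)
  \<comment> \<open>With \<open>size T \<le> k + 1 + n * k\<close>, the length is at most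
    \<open>11 * n * k + 2 * n + 3 * k + 6\<close>, and 11 + 2 + 3 + 6 = 22.\<close>
  have "length M \<le> 22 * (n * k)" using lenM nR nk T(2) m by linarith
  then have size: "length M \<le> 22 * n * k" by (simp add: mult.assoc)
  have small: "6 * k + n < length M" "R < length M" "k < length M"
    using lenM nR nk R_def by linarith+
  have root: "root < length M"
  proof (cases T)
    case Leaf
    then show ?thesis using lenM by (simp add: root_def)
  next
    case Node
    then show ?thesis using lenM by (simp add: root_def)
  qed
  \<comment> \<open>Every stored value is below the memory length, so words that hold all addresses
    also hold all contents.\<close>
  have cell_less: "cell z i < length M" if "z < n" "i < R" for z i
  proof -
    consider "i = 0" | "0 < i" "i \<le> k + 1" "\<psi> z (i - 1) = None"
      | q where "0 < i" "i \<le> k + 1" "\<psi> z (i - 1) = Some q" | "k + 1 < i"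
      by fastforce
    then show ?thesis
    proof cases
      case 1
      then show ?thesis using blk[OF that(1)] m small by (simp add: cell_def)
    next
      case 2
      then have "cell z i = 0" by (simp add: cell_def)
      then show ?thesis using small(3) by linarith
    next
      case (3 q)
      have "q < n" using \<psi>_less[OF that(1) 3(3)] .
      then have "q * R + 3 + (k + 2) < 3 + n * R" by (rule addr) (simp add: R_def \<open>0 < k\<close>)
      then show ?thesis using 3 lenM by (simp add: cell_def)
    next
      case 4
      then show ?thesis using E_le[OF that(1), of "i - (k + 2)"] small by (simp add: cell_def)
    qed
  qed
  have entries: "e < 2 ^ w" if "e \<in> set M" for e
  proof -
    have "e < length M"
    proof (cases "e \<in> set xs")
      case True
      then show ?thesis using small root cell_less
        by (auto simp: xs_def less_mult_imp_div_less R_def)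
    next
      case False
      then have "e \<in> set (layout (length xs) T)" using that by (simp add: M_def)
      from layout_entries[OF this] show ?thesis using xs lenM T(1) small by auto
    qed
    then show ?thesis using size w by simp
  qed
  let ?le = "\<lambda>x z. x \<sqsubseteq> z"
  interpret join_memory w n k R root M T ?le
  proof
    show "length M \<le> 2 ^ w" using size w by simp
    then show "n \<le> 2 ^ w" using small by simp
    show "4 < length M" using small \<open>0 < k\<close> by simp
    show "M ! 0 = k" "M ! 1 = R" "M ! 2 = root" by (simp_all add: M_def xs_def)
    show "tree_at M root T" unfolding M_def root_def
      using tree_at_layout[of xs T "[]"] unfolding xs by simp
    show "set_tree T \<subseteq> {..<n}" by fact
    fix x assume x: "x < n"
    have j: "M ! (x * R + 3) = blk x" "x * R + 3 < length M"
      using lookup[OF x, of 0] by (simp_all add: R_def cell_def)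
    then show "x * R + 3 < length M" by simp
    fix z assume z: "z < n"
    have bj: "1 + blk x < R" "1 + blk x \<le> k + 1" using blk[OF x] m by (auto simp: R_def)
    have sum: "z * R + 4 + blk x = z * R + 3 + (1 + blk x)" by simp
    have entry: "M ! (z * R + 4 + M ! (x * R + 3)) =
        (case \<psi> z (blk x) of None \<Rightarrow> 0 | Some q \<Rightarrow> q * R + k + 5)"
      "z * R + 4 + M ! (x * R + 3) < length M"
      using lookup[OF z bj(1)] bj(2) unfolding j(1) sum by (simp_all add: cell_def)
    then show "z * R + 4 + M ! (x * R + 3) < length M" by simp
    show "?le x z" if "M ! (z * R + 4 + M ! (x * R + 3)) = 0"
      using that \<psi>_iff[OF z x] unfolding entry(1) by (simp split: option.splits)
    fix a assume a: "M ! (z * R + 4 + M ! (x * R + 3)) = a" "a \<noteq> 0"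
    then obtain q where q: "\<psi> z (blk x) = Some q" "a = q * R + k + 5"
      unfolding entry(1) by (auto split: option.splits)
    have "q < n" using \<psi>_less[OF z q(1)] .
    have cells: "M ! (i + a) = E q i" "i + a < length M" if "i < 7 * k" for i
      using lookup[OF \<open>q < n\<close>, of "k + 2 + i"] that by (simp_all add: q(2) R_def cell_def algebra_simps)
    have v: "x mod k < 7 * k" using mod_less_divisor[OF \<open>0 < k\<close>, of x] by linarith
    note Ex = E[OF \<open>q < n\<close> x]
    have le: "?le x z \<longleftrightarrow> x \<in> tab q" using \<psi>_iff[OF z x] q(1) by simp
    have 1: "M ! (a + x mod k) = E q (x mod k)" "a + x mod k < length M"
      using cells[OF v] by (simp_all add: add.commute)
    have "E q (x mod k) + x div k < 7 * k" using Ex by linarith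
    note 2 = cells[OF this]
    note 3 = cells[OF Ex[THEN conjunct2, THEN conjunct1]]
    show "a + x mod k < length M \<and>
      M ! (a + x mod k) + x div k + a < length M \<and>
      M ! (M ! (a + x mod k) + x div k + a) + x mod k + a < length M \<and>
      (M ! (M ! (M ! (a + x mod k) + x div k + a) + x mod k + a) = x \<longleftrightarrow> ?le x z)"
      unfolding 1 2 3 le using 1 2 3 Ex by simp
  qed
  have "\<exists>\<tau>\<le>34 * (2 * k + 1 + max_degree L) + 19. answers_in w join_program M x y (x \<squnion>\<^bsub>L\<^esub> y) \<tau>"
    if xy: "x < n" "y < n" for x y
  proof -
    let ?P = "\<lambda>z. x \<sqsubseteq> z \<and> y \<sqsubseteq> z" and ?z = "x \<squnion>\<^bsub>L\<^esub> y"
    have xy': "x \<in> carrier L" "y \<in> carrier L" using xy carrier by auto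
    have least: "least L ?z (Upper L {x, y})" using join_least[OF top xy'] .
    then have "?z \<in> Upper L {x, y}" "\<And>u. u \<in> Upper L {x, y} \<Longrightarrow> ?z \<sqsubseteq> u"
      by (auto simp: least_def)
    then have z: "?z \<in> carrier L" "x \<sqsubseteq> ?z" "y \<sqsubseteq> ?z"
      and min: "\<And>u. \<lbrakk>u \<in> carrier L; x \<sqsubseteq> u; y \<sqsubseteq> u\<rbrakk> \<Longrightarrow> ?z \<sqsubseteq> u"
      using xy' by (auto simp: Upper_def)
    \<comment> \<open>By leastness, the common upper bounds are exactly the elements above the join,
      as the search tree requires.\<close>
    have "?P u \<longleftrightarrow> ?z \<sqsubseteq> u" if "u < n" for u
    proof -
      have "u \<in> carrier L" using that carrier by simp
      then show ?thesis
        using min[of u] le_trans[of x ?z u] le_trans[of y ?z u] z xy' by blast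
    qed
    then have s: "search ?P c T = ?z" "probes ?P T \<le> m + max_degree L + k" for c
      using search[of ?z ?P c] z(1) carrier by auto
    obtain \<tau> c where "\<tau> \<le> 34 * probes ?P T + 19"
      "answers_in w join_program M x y (search ?P c T) \<tau>"
      using join_program_correct[OF xy] by blast
    then show ?thesis using s m by (intro exI[of _ \<tau>]) simp
  qed
  then show ?thesis using entries size by blast
qed

section \<open>Constants and asymptotic bounds\<close>

theorem theorem11:
  shows "\<exists>(P :: program) (\<kappa> :: real) (c :: real).
    \<forall>(n :: nat) (L :: nat gorder) (w :: nat).
      partial_lattice L \<longrightarrow> carrier L = {..<n} \<longrightarrow> (\<exists>t. greatest L t (carrier L)) \<longrightarrow>
      \<kappa> * log 2 (real n + 1) \<le> real w \<longrightarrow>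
      (\<exists>M. join_structure w P L M
             (c * real n powr (3 / 2))
             (c * (sqrt (real n) + real (max_degree L))))"
proof (rule exI[of _ join_program], rule exI[of _ 8], rule exI[of _ 189], intro allI impI)
  fix n w :: nat and L :: "nat gorder"
  assume L: "partial_lattice L" and carrier: "carrier L = {..<n}"
    and ex_top: "\<exists>t. greatest L t (carrier L)" and w: "8 * log 2 (real n + 1) \<le> real w"
  obtain t where top: "greatest L t (carrier L)" using ex_top ..
  then have n: "1 \<le> n" using carrier by (auto simp: greatest_def)
  define k where "k = nat \<lceil>sqrt (real n)\<rceil>"
  have sqrt1: "1 \<le> sqrt (real n)" using n by simp
  have k_ge: "sqrt (real n) \<le> real k" unfolding k_def by linarith
  have k_le: "real k \<le> 2 * sqrt (real n)" unfolding k_def using sqrt1 by linarith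
  have "0 < k" using k_ge sqrt1 by linarith
  have "real n = sqrt (real n) * sqrt (real n)" by simp
  also have "\<dots> \<le> real k * real k" using k_ge by (intro mult_mono) auto
  finally have nk: "n \<le> k * k" by (simp flip: of_nat_mult)
  have "real (22 * n * k) \<le> 22 * real n * (2 * real n)"
  proof -
    have "sqrt (real n) \<le> real n" using n by (simp add: real_le_lsqrt power2_eq_square)
    then have "real k \<le> 2 * real n" using k_le by linarith
    then show ?thesis using mult_left_mono[of "real k" "2 * real n" "22 * real n"] by simp
  qed
  \<comment> \<open>The factor 44 is absorbed by \<open>2 ^ 6\<close>, and this by
    \<open>(n + 1) ^ 6\<close> as \<open>n \<ge> 1\<close>. The resulting exponent 8 is the constant
    \<kappa> of the word length.\<close>
  also have "\<dots> \<le> 2 ^ 6 * (real n + 1) ^ 2" by (simp add: power2_eq_square algebra_simps)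
  also have "\<dots> \<le> (real n + 1) ^ 6 * (real n + 1) ^ 2"
    using n by (intro mult_right_mono power_mono) auto
  also have "\<dots> = (real n + 1) ^ 8" by (simp flip: power_add)
  also have "\<dots> = (2 powr log 2 (real n + 1)) powr 8" using powr_realpow[of "real n + 1" 8] by simp
  also have "\<dots> = 2 powr (8 * log 2 (real n + 1))" by (simp only: powr_powr mult.commute)
  also have "\<dots> \<le> 2 powr real w" using w by simp
  also have "\<dots> = real (2 ^ w)" by (simp add: powr_realpow)
  finally have w': "22 * n * k \<le> 2 ^ w" by (simp only: of_nat_le_iff)
  obtain M where M: "\<forall>e\<in>set M. e < 2 ^ w" "length M \<le> 22 * n * k"
    "\<And>x y. \<lbrakk>x < n; y < n\<rbrakk> \<Longrightarrow> \<exists>\<tau>\<le>34 * (2 * k + 1 + max_degree L) + 19.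
       answers_in w join_program M x y (x \<squnion>\<^bsub>L\<^esub> y) \<tau>"
    using exists_join_memory[OF L carrier top nk \<open>0 < k\<close> w'] by blast
  have "real (length M) \<le> real (22 * n * k)" using M(2) by (simp only: of_nat_le_iff)
  also have "\<dots> \<le> 22 * real n * (2 * sqrt (real n))"
    using mult_left_mono[OF k_le, of "22 * real n"] by simp
  also have "\<dots> \<le> 189 * (real n * sqrt (real n))" by simp
  also have "real n * sqrt (real n) = real n powr (3 / 2)"
  proof -
    have "real n powr (3 / 2) = real n powr 1 * real n powr (1 / 2)"
      by (simp only: powr_add[symmetric]) simp
    then show ?thesis by (simp add: powr_half_sqrt)
  qed
  finally have space: "real (length M) \<le> 189 * real n powr (3 / 2)" .
  have time: "real \<tau> \<le> 189 * (sqrt (real n) + real (max_degree L))"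
    if "\<tau> \<le> 34 * (2 * k + 1 + max_degree L) + 19" for \<tau>
  proof -
    have "real \<tau> \<le> real (34 * (2 * k + 1 + max_degree L) + 19)" using that by (simp only: of_nat_le_iff)
    also have "\<dots> = 68 * real k + 34 * real (max_degree L) + 53" by simp
    \<comment> \<open>From \<open>k \<le> 2 * sqrt n\<close> and \<open>1 \<le> sqrt n\<close>, the
      coefficient of \<open>sqrt n\<close> is 136 + 53 = 189.\<close>
    also have "\<dots> \<le> 189 * (sqrt (real n) + real (max_degree L))"
      unfolding distrib_left
      using k_le sqrt1 of_nat_0_le_iff[where 'a = real, of "max_degree L"] by linarith
    finally show ?thesis .
  qed
  have "\<exists>\<tau>. real \<tau> \<le> 189 * (sqrt (real n) + real (max_degree L)) \<and>
      answers_in w join_program M x y (x \<squnion>\<^bsub>L\<^esub> y) \<tau>"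
    if xy: "x < n" "y < n" for x y
  proof -
    obtain \<tau> where "\<tau> \<le> 34 * (2 * k + 1 + max_degree L) + 19"
      and "answers_in w join_program M x y (x \<squnion>\<^bsub>L\<^esub> y) \<tau>"
      using M(3)[OF xy] by (elim exE conjE)
    then show ?thesis using time by (intro exI[of _ \<tau>]) simp
  qed
  then show "\<exists>M. join_structure w join_program L M (189 * real n powr (3 / 2))
     (189 * (sqrt (real n) + real (max_degree L)))"
    unfolding join_structure_def using M(1) space carrier by (intro exI[of _ M]) auto
qed

end
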